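(* Let $(M^n,g_t,b_t)$ be a smooth one-parameter family of Riemannian metrics and two-forms with $H_t=H_0+db_t$, $H_0$ a fixed closed three-form. Suppose $u$ is a smooth function on spacetime solving the time-dependent heat equation $\partial_tu=\Delta_{g_t}u$. Then $$\nabla_t\,\mathrm{grad}_{g_t}u=\Delta\,\mathrm{grad}_{g_t}u-\Big(\mathrm{Rc}^\nabla+\tfrac12\partial_t(g_t-b_t)\Big)\big(\mathrm{grad}_{g_t}u,\cdot\big)^{\sharp_{g_t}}.$$
   Context: $D$ is the Levi-Civita connection of $g_t$ and $\nabla=D+\tfrac12 g^{-1}H$ the Bismut connection, i.e. $\nabla_XY=D_XY+\tfrac12H(X,Y,\cdot)^\sharp$. $\Delta=\mathrm{tr}_g\nabla\nabla$ is the Laplacian of $\nabla$; on functions it equals the usual Laplacian, but on vector fields it is the Bismut Laplacian. $\mathrm{Rc}^\nabla=\mathrm{Rc}-\tfrac14H^2-\tfrac12d^*_gH$ is the Ricci tensor of $\nabla$, where $H^2(X,Y)=\langle X\lrcorner H,Y\lrcorner H\rangle$ (tensor inner product, $H^2_{ij}=g^{kl}g^{pq}H_{ikp}H_{jlq}$) and $(d^*_gH)_{jk}=-D^iH_{ijk}$. On the pullback of $TM$ to $M\times I$, $\nabla$ is extended in the time direction by $$\nabla_tY=\partial_tY+\tfrac12\partial_t(g_t+b_t)(Y,\cdot)^{\sharp_{g_t}}.$$ *)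

theory Defs
  imports "HOL-Analysis.Analysis"
begin

section \<open>Smooth maps\<close>

primrec Ck_on :: "nat \<Rightarrow> 'a::real_normed_vector set \<Rightarrow> ('a \<Rightarrow> 'b::real_normed_vector) \<Rightarrow> bool" where
  "Ck_on 0 S f \<longleftrightarrow> continuous_on S f"
| "Ck_on (Suc k) S f \<longleftrightarrow>
     (\<forall>x\<in>S. f differentiable (at x)) \<and> (\<forall>v. Ck_on k S (\<lambda>x. frechet_derivative f (at x) v))"

text \<open>The set S need not be open (it may be a chart image times a half-open time interval):
  smooth means that f locally extends to a smooth map on an open set.\<close>

definition smooth_on :: "'a::real_normed_vector set \<Rightarrow> ('a \<Rightarrow> 'b::real_normed_vector) \<Rightarrow> bool" where
  "smooth_on S f \<longleftrightarrow>
     (\<forall>x\<in>S. \<exists>W F. open W \<and> x \<in> W \<and> (\<forall>k. Ck_on k W F) \<and> (\<forall>y\<in>W \<inter> S. F y = f y))"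


section \<open>Smooth manifolds of dimension CARD('n)\<close>

text \<open>A chart is a domain together with its coordinate map. The manifold is the whole type 'm,
  whose class constraints (Hausdorff, second countable) appear at the places of use.\<close>

type_synonym ('m, 'n) chart = "'m set \<times> ('m \<Rightarrow> real^'n)"

abbreviation chart_dom :: "('m, 'n) chart \<Rightarrow> 'm set" where
  "chart_dom c \<equiv> fst c"

abbreviation chart_map :: "('m, 'n) chart \<Rightarrow> 'm \<Rightarrow> real^'n" where
  "chart_map c \<equiv> snd c"

abbreviation chart_img :: "('m, 'n) chart \<Rightarrow> (real^'n) set" where
  "chart_img c \<equiv> snd c ` fst c"

abbreviation chart_inv :: "('m, 'n) chart \<Rightarrow> real^'n \<Rightarrow> 'm" where
  "chart_inv c \<equiv> inv_into (fst c) (snd c)"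

definition smooth_manifold ::
    "('m::{t2_space,second_countable_topology}, 'n::finite) chart set \<Rightarrow> bool" where
  "smooth_manifold A \<longleftrightarrow>
     (\<forall>c\<in>A. open (chart_dom c) \<and> open (chart_img c) \<and>
            homeomorphism (chart_dom c) (chart_img c) (chart_map c) (chart_inv c)) \<and>
     (\<Union>c\<in>A. chart_dom c) = UNIV \<and>
     (\<forall>c\<in>A. \<forall>c'\<in>A.
        smooth_on (chart_map c ` (chart_dom c \<inter> chart_dom c')) (chart_map c' \<circ> chart_inv c))"

text \<open>The derivative of f along the i-th coordinate field of the chart c.\<close>

definition pd :: "('m, 'n::finite) chart \<Rightarrow> 'n \<Rightarrow> ('m \<Rightarrow> 'b::real_normed_vector) \<Rightarrow> 'm \<Rightarrow> 'b" where
  "pd c i f p = frechet_derivative (f \<circ> chart_inv c) (at (chart_map c p)) (axis i 1)"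

text \<open>jac c c' p \$ a \$ i is the derivative of the a-th coordinate of c' along the i-th
  coordinate field of c.\<close>

definition jac :: "('m, 'n::finite) chart \<Rightarrow> ('m, 'n) chart \<Rightarrow> 'm \<Rightarrow> real^'n^'n" where
  "jac c c' p = (\<chi> a i. pd c i (chart_map c') p $ a)"


section \<open>Tensor fields\<close>

text \<open>A tensor field is given by its component functions in every chart, which are functions
  of the point of the manifold.\<close>

type_synonym ('m, 'n) tensor2 = "('m, 'n) chart \<Rightarrow> 'm \<Rightarrow> real^'n^'n"
type_synonym ('m, 'n) tensor3 = "('m, 'n) chart \<Rightarrow> 'm \<Rightarrow> real^'n^'n^'n"

definition smooth_components ::
    "('m, 'n::finite) chart set \<Rightarrow> (('m, 'n) chart \<Rightarrow> 'm \<Rightarrow> 'b::real_normed_vector) \<Rightarrow> bool" where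
  "smooth_components A T \<longleftrightarrow> (\<forall>c\<in>A. smooth_on (chart_img c) (\<lambda>x. T c (chart_inv c x)))"

text \<open>Joint smoothness in space and time.\<close>

definition smooth_family ::
    "('m, 'n::finite) chart set \<Rightarrow> real set \<Rightarrow>
     (real \<Rightarrow> ('m, 'n) chart \<Rightarrow> 'm \<Rightarrow> 'b::real_normed_vector) \<Rightarrow> bool" where
  "smooth_family A I T \<longleftrightarrow>
     (\<forall>c\<in>A. smooth_on (chart_img c \<times> I) (\<lambda>(x, t). T t c (chart_inv c x)))"

definition tensor2_field :: "('m, 'n::finite) chart set \<Rightarrow> ('m, 'n) tensor2 \<Rightarrow> bool" where
  "tensor2_field A T \<longleftrightarrow> smooth_components A T \<and>
     (\<forall>c\<in>A. \<forall>c'\<in>A. \<forall>p \<in> chart_dom c \<inter> chart_dom c'. \<forall>i j.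
        T c p $ i $ j =
          (\<Sum>a\<in>UNIV. \<Sum>b\<in>UNIV. jac c c' p $ a $ i * jac c c' p $ b $ j * T c' p $ a $ b))"

definition tensor3_field :: "('m, 'n::finite) chart set \<Rightarrow> ('m, 'n) tensor3 \<Rightarrow> bool" where
  "tensor3_field A T \<longleftrightarrow> smooth_components A T \<and>
     (\<forall>c\<in>A. \<forall>c'\<in>A. \<forall>p \<in> chart_dom c \<inter> chart_dom c'. \<forall>i j k.
        T c p $ i $ j $ k =
          (\<Sum>a\<in>UNIV. \<Sum>b\<in>UNIV. \<Sum>d\<in>UNIV.
             jac c c' p $ a $ i * jac c c' p $ b $ j * jac c c' p $ d $ k * T c' p $ a $ b $ d))"

definition riemannian_metric :: "('m, 'n::finite) chart set \<Rightarrow> ('m, 'n) tensor2 \<Rightarrow> bool" where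
  "riemannian_metric A g \<longleftrightarrow> tensor2_field A g \<and>
     (\<forall>c\<in>A. \<forall>p\<in>chart_dom c.
        transpose (g c p) = g c p \<and> (\<forall>v. v \<noteq> 0 \<longrightarrow> v \<bullet> (g c p *v v) > 0))"

definition two_form :: "('m, 'n::finite) chart set \<Rightarrow> ('m, 'n) tensor2 \<Rightarrow> bool" where
  "two_form A b \<longleftrightarrow> tensor2_field A b \<and>
     (\<forall>c\<in>A. \<forall>p\<in>chart_dom c. \<forall>i j. b c p $ i $ j = - b c p $ j $ i)"

definition three_form :: "('m, 'n::finite) chart set \<Rightarrow> ('m, 'n) tensor3 \<Rightarrow> bool" where
  "three_form A H \<longleftrightarrow> tensor3_field A H \<and>
     (\<forall>c\<in>A. \<forall>p\<in>chart_dom c. \<forall>i j k.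
        H c p $ i $ j $ k = - H c p $ j $ i $ k \<and> H c p $ i $ j $ k = - H c p $ i $ k $ j)"

text \<open>Exterior derivatives, normalised without combinatorial factors.\<close>

definition ext_d2 :: "('m, 'n::finite) tensor2 \<Rightarrow> ('m, 'n) tensor3" where
  "ext_d2 b c p = (\<chi> i j k.
     pd c i (\<lambda>q. b c q $ j $ k) p - pd c j (\<lambda>q. b c q $ i $ k) p + pd c k (\<lambda>q. b c q $ i $ j) p)"

definition closed_three_form :: "('m, 'n::finite) chart set \<Rightarrow> ('m, 'n) tensor3 \<Rightarrow> bool" where
  "closed_three_form A H \<longleftrightarrow> three_form A H \<and>
     (\<forall>c\<in>A. \<forall>p\<in>chart_dom c. \<forall>i j k l.
        pd c i (\<lambda>q. H c q $ j $ k $ l) p - pd c j (\<lambda>q. H c q $ i $ k $ l) p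
      + pd c k (\<lambda>q. H c q $ i $ j $ l) p - pd c l (\<lambda>q. H c q $ i $ j $ k) p = 0)"

text \<open>The vector dual to the covector w with respect to the metric G at a point, and the trace
  of a bilinear map B (on basis vectors) with respect to G.\<close>

definition sharp :: "real^'n^'n::finite \<Rightarrow> real^'n \<Rightarrow> real^'n" where
  "sharp G w = matrix_inv G *v w"

definition metric_trace :: "real^'n^'n::finite \<Rightarrow> ('n \<Rightarrow> 'n \<Rightarrow> 'b::real_vector) \<Rightarrow> 'b" where
  "metric_trace G B = (\<Sum>i\<in>UNIV. \<Sum>j\<in>UNIV. (matrix_inv G $ i $ j) *\<^sub>R B i j)"

definition grad :: "('m, 'n::finite) tensor2 \<Rightarrow> ('m \<Rightarrow> real) \<Rightarrow> ('m, 'n) chart \<Rightarrow> 'm \<Rightarrow> real^'n" where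
  "grad g f c p = sharp (g c p) (\<chi> i. pd c i f p)"


section \<open>Connections\<close>

text \<open>A vector field on the domain of a fixed chart is represented by its components
  'm => real^'n in that chart; the coordinate fields have constant components.\<close>

type_synonym ('m, 'n) vfield = "'m \<Rightarrow> real^'n"

definition coord_field :: "'n::finite \<Rightarrow> ('m, 'n) vfield" where
  "coord_field i = (\<lambda>p. axis i 1)"

definition dir_deriv ::
    "('m, 'n::finite) chart \<Rightarrow> ('m, 'n) vfield \<Rightarrow> ('m \<Rightarrow> 'b::real_normed_vector) \<Rightarrow> 'm \<Rightarrow> 'b" where
  "dir_deriv c X f p = (\<Sum>i\<in>UNIV. (X p $ i) *\<^sub>R pd c i f p)"

definition lie_bracket ::
    "('m, 'n::finite) chart \<Rightarrow> ('m, 'n) vfield \<Rightarrow> ('m, 'n) vfield \<Rightarrow> ('m, 'n) vfield" where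
  "lie_bracket c X Y p = dir_deriv c X Y p - dir_deriv c Y X p"

text \<open>A connection on the tangent bundle is given by its coefficients in every chart:
  G c p \$ k \$ i \$ j is the k-th component of the covariant derivative of the j-th coordinate
  field along the i-th one. Under a change of charts they obey the usual inhomogeneous law.\<close>

definition affine_connection :: "('m, 'n::finite) chart set \<Rightarrow> ('m, 'n) tensor3 \<Rightarrow> bool" where
  "affine_connection A G \<longleftrightarrow> smooth_components A G \<and>
     (\<forall>c\<in>A. \<forall>c'\<in>A. \<forall>p \<in> chart_dom c \<inter> chart_dom c'. \<forall>a i j.
        (\<Sum>k\<in>UNIV. jac c c' p $ a $ k * G c p $ k $ i $ j) =
          (\<Sum>b\<in>UNIV. \<Sum>d\<in>UNIV. jac c c' p $ b $ i * jac c c' p $ d $ j * G c' p $ a $ b $ d)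
          + pd c i (\<lambda>q. jac c c' q $ a $ j) p)"

definition cov_deriv ::
    "('m, 'n::finite) tensor3 \<Rightarrow> ('m, 'n) chart \<Rightarrow>
     ('m, 'n) vfield \<Rightarrow> ('m, 'n) vfield \<Rightarrow> ('m, 'n) vfield" where
  "cov_deriv G c X Y p = dir_deriv c X Y p
     + (\<chi> k. \<Sum>i\<in>UNIV. \<Sum>j\<in>UNIV. G c p $ k $ i $ j * X p $ i * Y p $ j)"

text \<open>The last two conditions are vanishing torsion and compatibility with the metric,
  evaluated on coordinate fields.\<close>

definition levi_civita ::
    "('m, 'n::finite) chart set \<Rightarrow> ('m, 'n) tensor2 \<Rightarrow> ('m, 'n) tensor3 \<Rightarrow> bool" where
  "levi_civita A g G \<longleftrightarrow> affine_connection A G \<and>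
     (\<forall>c\<in>A. \<forall>p\<in>chart_dom c. \<forall>i j k. G c p $ k $ i $ j = G c p $ k $ j $ i) \<and>
     (\<forall>c\<in>A. \<forall>p\<in>chart_dom c. \<forall>i j k.
        pd c k (\<lambda>q. g c q $ i $ j) p =
          (\<Sum>l\<in>UNIV. G c p $ l $ k $ i * g c p $ l $ j + G c p $ l $ k $ j * g c p $ i $ l))"

text \<open>The Bismut connection of g and H, where G is the Levi-Civita connection of g.\<close>

definition bismut ::
    "('m, 'n::finite) tensor2 \<Rightarrow> ('m, 'n) tensor3 \<Rightarrow> ('m, 'n) tensor3 \<Rightarrow> ('m, 'n) chart \<Rightarrow>
     ('m, 'n) vfield \<Rightarrow> ('m, 'n) vfield \<Rightarrow> ('m, 'n) vfield" where
  "bismut g H G c X Y p = cov_deriv G c X Y p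
     + (1/2) *\<^sub>R sharp (g c p) (\<chi> k. \<Sum>i\<in>UNIV. \<Sum>j\<in>UNIV. H c p $ i $ j $ k * X p $ i * Y p $ j)"

text \<open>Laplacians of a connection nab on functions and on vector fields: metric traces of
  X (Y f) - (nab X Y) f and of nab X (nab Y Z) - nab (nab X Y) Z, which are
  tensorial in X and Y.\<close>

definition laplacian_fun ::
    "('m, 'n::finite) tensor2 \<Rightarrow> ('m, 'n) chart \<Rightarrow>
     (('m, 'n) vfield \<Rightarrow> ('m, 'n) vfield \<Rightarrow> ('m, 'n) vfield) \<Rightarrow> ('m \<Rightarrow> real) \<Rightarrow> 'm \<Rightarrow> real" where
  "laplacian_fun g c nab f p = metric_trace (g c p) (\<lambda>i j.
     dir_deriv c (coord_field i) (dir_deriv c (coord_field j) f) p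
     - dir_deriv c (nab (coord_field i) (coord_field j)) f p)"

definition laplacian_vec ::
    "('m, 'n::finite) tensor2 \<Rightarrow> ('m, 'n) chart \<Rightarrow>
     (('m, 'n) vfield \<Rightarrow> ('m, 'n) vfield \<Rightarrow> ('m, 'n) vfield) \<Rightarrow> ('m, 'n) vfield \<Rightarrow> ('m, 'n) vfield" where
  "laplacian_vec g c nab Z p = metric_trace (g c p) (\<lambda>i j.
     nab (coord_field i) (nab (coord_field j) Z) p
     - nab (nab (coord_field i) (coord_field j)) Z p)"


section \<open>Curvature\<close>

definition riemann ::
    "('m, 'n::finite) tensor3 \<Rightarrow> ('m, 'n) chart \<Rightarrow>
     ('m, 'n) vfield \<Rightarrow> ('m, 'n) vfield \<Rightarrow> ('m, 'n) vfield \<Rightarrow> ('m, 'n) vfield" where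
  "riemann G c X Y Z p =
     cov_deriv G c X (cov_deriv G c Y Z) p - cov_deriv G c Y (cov_deriv G c X Z) p
     - cov_deriv G c (lie_bracket c X Y) Z p"

text \<open>Rc(Y,Z) is the trace of the endomorphism sending X to R(X,Y)Z.\<close>

definition ricci :: "('m, 'n::finite) tensor3 \<Rightarrow> ('m, 'n) tensor2" where
  "ricci G c p = (\<chi> j k. \<Sum>i\<in>UNIV.
     riemann G c (coord_field i) (coord_field j) (coord_field k) p $ i)"

definition H_squared :: "('m, 'n::finite) tensor2 \<Rightarrow> ('m, 'n) tensor3 \<Rightarrow> ('m, 'n) tensor2" where
  "H_squared g H c p = (\<chi> i j. \<Sum>k\<in>UNIV. \<Sum>l\<in>UNIV. \<Sum>r\<in>UNIV. \<Sum>s\<in>UNIV.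
     matrix_inv (g c p) $ k $ l * matrix_inv (g c p) $ r $ s * H c p $ i $ k $ r * H c p $ j $ l $ s)"

text \<open>The (l,i,j,k)-component of the covariant derivative of H, l being the direction of
  differentiation.\<close>

definition cov_deriv3 ::
    "('m, 'n::finite) tensor3 \<Rightarrow> ('m, 'n) tensor3 \<Rightarrow> ('m, 'n) chart \<Rightarrow> 'n \<Rightarrow> 'n \<Rightarrow> 'n \<Rightarrow> 'n \<Rightarrow> 'm \<Rightarrow> real" where
  "cov_deriv3 G H c l i j k p = pd c l (\<lambda>q. H c q $ i $ j $ k) p
     - (\<Sum>m\<in>UNIV. G c p $ m $ l $ i * H c p $ m $ j $ k
              + G c p $ m $ l $ j * H c p $ i $ m $ k
              + G c p $ m $ l $ k * H c p $ i $ j $ m)"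

definition codiff3 ::
    "('m, 'n::finite) tensor2 \<Rightarrow> ('m, 'n) tensor3 \<Rightarrow> ('m, 'n) tensor3 \<Rightarrow> ('m, 'n) tensor2" where
  "codiff3 g G H c p = (\<chi> j k. - metric_trace (g c p) (\<lambda>l i. cov_deriv3 G H c l i j k p))"

definition bismut_ricci ::
    "('m, 'n::finite) tensor2 \<Rightarrow> ('m, 'n) tensor3 \<Rightarrow> ('m, 'n) tensor3 \<Rightarrow> ('m, 'n) tensor2" where
  "bismut_ricci g H G c p =
     ricci G c p - (1/4) *\<^sub>R H_squared g H c p - (1/2) *\<^sub>R codiff3 g G H c p"


section \<open>Time derivatives\<close>

text \<open>One-sided at an end point of the time interval I.\<close>

definition dt :: "real set \<Rightarrow> real \<Rightarrow> (real \<Rightarrow> 'b::real_normed_vector) \<Rightarrow> 'b" where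
  "dt I t f = vector_derivative f (at t within I)"

text \<open>Here v v* T is the covector T(v, -): its j-th component is the sum over i of
  T \$ i \$ j * v \$ i.\<close>

definition nabla_t ::
    "real set \<Rightarrow> (real \<Rightarrow> ('m, 'n::finite) tensor2) \<Rightarrow> (real \<Rightarrow> ('m, 'n) tensor2) \<Rightarrow> ('m, 'n) chart \<Rightarrow>
     (real \<Rightarrow> ('m, 'n) vfield) \<Rightarrow> real \<Rightarrow> ('m, 'n) vfield" where
  "nabla_t I g b c Y t p = dt I t (\<lambda>s. Y s p)
     + (1/2) *\<^sub>R sharp (g t c p) (Y t p v* dt I t (\<lambda>s. g s c p + b s c p))"

end

(*
  Fix a chart and write h for the inverse metric, Gam i for the endomorphism D_{e_i} - d_i, and
  Hm i for the map Z |-> H(e_i, Z, -). Since D commutes with raising indices, the Bismut derivative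
  of h w along e_i is h applied to d_i w - w Gam_i + (1/2) Hm_i (h w). With Y = grad u the derivative
  of Y along e_j is h W_j, where W_j = Hess_j + (1/2) Hm_j Y. Expanding h^{ij} (D_i W_j + (1/2) Hm_i h W_j),
  the two terms that pair H with the Hessian vanish by symmetry, the term in DH gives the codifferential,
  the quadratic term gives H^2, and h^{ij} D_i Hess_j = d(Lap u) + Rc(Y, -) is the classical Bochner
  formula. Hence the Bismut Laplacian of grad u is grad (Lap u) + Rc^nabla(grad u, -)^sharp. The heat
  equation turns grad (Lap u) into grad (d_t u), which differs from d_t (grad u) by the time derivative
  of the inverse metric.
*)

theory Submission
  imports Defs
begin

section \<open>Smooth maps and mixed partial derivatives\<close>

text \<open>The trace in \<open>laplacian_vec\<close> also subtracts the derivative along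
  \<open>nab (coord_field i) (coord_field j)\<close>; the H part of that field is skew in i and j,
  so only its Levi-Civita part survives the trace. The Hessian pairings vanish for the same kind of
  reason: H(e_i, e_r, -) is skew in i and r, whereas h Hess h is symmetric. As to the constants of
  Rc^nabla, the 1/4 is the product of the two factors 1/2 in the connection, its minus sign comes
  from the one transposition that brings two copies of H into the pattern of H^2, and the sign of
  d^*H is the one in its definition. On the time side, d_t h = - h g' h contributes -g', and adding
  the term (1/2)(g' + b') of \<open>nabla_t\<close> leaves -(1/2)(g' - b'). All identities are
  written for matrix-valued functions in one chart, with the direction of differentiation as a
  separate index; the Leibniz rules are then instances of a single product rule for bilinear maps.
  The delicate analytic point is the interchange of d_t with spatial derivatives, since I may
  contain its end points.\<close>

lemma has_real_derivative_along_line: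
  fixes f :: "'a::real_normed_vector \<Rightarrow> real"
  assumes "f differentiable (at (x + s *\<^sub>R v))"
  shows "((\<lambda>s. f (x + s *\<^sub>R v)) has_real_derivative frechet_derivative f (at (x + s *\<^sub>R v)) v) (at s)"
proof -
  let ?D = "frechet_derivative f (at (x + s *\<^sub>R v))"
  have D: "(f has_derivative ?D) (at (x + s *\<^sub>R v))"
    using assms frechet_derivative_works by blast
  have "((\<lambda>s. x + s *\<^sub>R v) has_derivative (\<lambda>s. s *\<^sub>R v)) (at s)"
    by (auto intro!: derivative_eq_intros)
  from has_derivative_compose[OF this D]
  have "((\<lambda>s. f (x + s *\<^sub>R v)) has_derivative (\<lambda>s. ?D (s *\<^sub>R v))) (at s)" .
  moreover have "(\<lambda>s. ?D (s *\<^sub>R v)) = (*) (?D v)"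
    using linear_frechet_derivative[OF assms] by (auto simp: linear_cmul mult.commute)
  ultimately show ?thesis
    unfolding has_field_derivative_def by metis
qed

text \<open>The mean value theorem is applied twice: to the increment in direction w as a function
  of the parameter along v, then to the derivative along v as a function of the parameter along w.
  The left side is symmetric in v and w, which is what makes the formula useful.\<close>

lemma second_difference:
  fixes f :: "'a::real_normed_vector \<Rightarrow> real"
  assumes h: "h > 0"
    and U: "\<And>s r. 0 \<le> s \<Longrightarrow> s \<le> h \<Longrightarrow> 0 \<le> r \<Longrightarrow> r \<le> h \<Longrightarrow> x + s *\<^sub>R v + r *\<^sub>R w \<in> U"
    and f: "\<And>y. y \<in> U \<Longrightarrow> f differentiable (at y)"
    and fv: "\<And>y. y \<in> U \<Longrightarrow> (\<lambda>y. frechet_derivative f (at y) v) differentiable (at y)"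
  obtains s r where "0 \<le> s" "s \<le> h" "0 \<le> r" "r \<le> h"
    "f (x + h *\<^sub>R v + h *\<^sub>R w) - f (x + h *\<^sub>R v) - f (x + h *\<^sub>R w) + f x =
      h * h * frechet_derivative (\<lambda>y. frechet_derivative f (at y) v) (at (x + s *\<^sub>R v + r *\<^sub>R w)) w"
proof -
  let ?fv = "\<lambda>y. frechet_derivative f (at y) v"
  let ?g = "\<lambda>s. f ((x + h *\<^sub>R w) + s *\<^sub>R v) - f (x + s *\<^sub>R v)"
  have U0: "x + s *\<^sub>R v \<in> U" if "0 \<le> s" "s \<le> h" for s
    using U[OF that, of 0] h by simp
  have U1: "(x + h *\<^sub>R w) + s *\<^sub>R v \<in> U" if "0 \<le> s" "s \<le> h" for s
    using U[OF that, of h] h by (simp add: algebra_simps)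
  have g': "(?g has_real_derivative (?fv ((x + h *\<^sub>R w) + s *\<^sub>R v) - ?fv (x + s *\<^sub>R v))) (at s)"
    if "0 \<le> s" "s \<le> h" for s
    using that by (intro DERIV_diff has_real_derivative_along_line[OF f] U0 U1)
  obtain s where s: "0 < s" "s < h" and
    s_eq: "?g h - ?g 0 = (h - 0) * (?fv ((x + h *\<^sub>R w) + s *\<^sub>R v) - ?fv (x + s *\<^sub>R v))"
    using MVT2[OF h, of ?g "\<lambda>s. ?fv ((x + h *\<^sub>R w) + s *\<^sub>R v) - ?fv (x + s *\<^sub>R v)"] g' by auto
  let ?k = "\<lambda>r. ?fv ((x + s *\<^sub>R v) + r *\<^sub>R w)"
  have k': "(?k has_real_derivative frechet_derivative ?fv (at ((x + s *\<^sub>R v) + r *\<^sub>R w)) w) (at r)"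
    if "0 \<le> r" "r \<le> h" for r
    by (rule has_real_derivative_along_line[OF fv]) (use s that U in auto)
  obtain r where r: "0 < r" "r < h" and
    r_eq: "?k h - ?k 0 = (h - 0) * frechet_derivative ?fv (at ((x + s *\<^sub>R v) + r *\<^sub>R w)) w"
    using MVT2[OF h, of ?k "\<lambda>r. frechet_derivative ?fv (at ((x + s *\<^sub>R v) + r *\<^sub>R w)) w"] k'
    by auto
  have "f (x + h *\<^sub>R v + h *\<^sub>R w) - f (x + h *\<^sub>R v) - f (x + h *\<^sub>R w) + f x = ?g h - ?g 0"
    by (simp add: algebra_simps)
  also have "\<dots> = h * (?k h - ?k 0)"
    unfolding s_eq by (simp add: algebra_simps)
  also have "\<dots> = h * h * frechet_derivative ?fv (at ((x + s *\<^sub>R v) + r *\<^sub>R w)) w"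
    unfolding r_eq by simp
  finally show thesis
    using that[of s r] s r by simp
qed

text \<open>One and the same second difference equals h * h times either mixed derivative, each
  taken at some point of a small parallelogram at x; continuity of both at x then forces equality up
  to every e > 0.\<close>

lemma frechet_derivative_commute_real:
  fixes f :: "'a::real_normed_vector \<Rightarrow> real"
  assumes "open U" "Ck_on 2 U f" "x \<in> U"
  shows "frechet_derivative (\<lambda>y. frechet_derivative f (at y) v) (at x) w =
    frechet_derivative (\<lambda>y. frechet_derivative f (at y) w) (at x) v"
    (is "?a x = ?b x")
proof -
  have f: "f differentiable (at y)" if "y \<in> U" for y
    using assms that by (simp add: numeral_2_eq_2)
  have fv: "(\<lambda>y. frechet_derivative f (at y) v) differentiable (at y)" if "y \<in> U" for y v
    using assms that by (simp add: numeral_2_eq_2)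
  have cont: "continuous_on U (\<lambda>x. frechet_derivative (\<lambda>y. frechet_derivative f (at y) v) (at x) w)" for v w
    using assms by (simp add: numeral_2_eq_2)
  have "\<bar>?a x - ?b x\<bar> \<le> e" if e: "e > 0" for e
  proof -
    obtain d where d: "d > 0" "ball x d \<subseteq> U"
        "\<And>y. y \<in> ball x d \<Longrightarrow> \<bar>?a y - ?a x\<bar> < e/2" "\<And>y. y \<in> ball x d \<Longrightarrow> \<bar>?b y - ?b x\<bar> < e/2"
    proof -
      obtain d0 where d0: "d0 > 0" "ball x d0 \<subseteq> U"
        using assms openE by blast
      obtain d1 where d1: "d1 > 0" "\<And>y. y \<in> U \<Longrightarrow> dist y x < d1 \<Longrightarrow> dist (?a y) (?a x) < e/2"
        using cont[of v w] \<open>x \<in> U\<close> e unfolding continuous_on_iff by (metis half_gt_zero)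
      obtain d2 where d2: "d2 > 0" "\<And>y. y \<in> U \<Longrightarrow> dist y x < d2 \<Longrightarrow> dist (?b y) (?b x) < e/2"
        using cont[of w v] \<open>x \<in> U\<close> e unfolding continuous_on_iff by (metis half_gt_zero)
      show thesis
        using that[of "min d0 (min d1 d2)"] d0 d1 d2
        by (auto simp: dist_commute dist_real_def subset_iff)
    qed
    \<comment> \<open>With this h the parallelogram spanned by h v and h w stays within distance d/2
      of x; the summand 1 keeps the denominator positive when v and w are both zero.\<close>
    define h where "h = d / (2 * (norm v + norm w + 1))"
    have h: "h > 0"
      using d by (simp add: h_def add_nonneg_pos)
    have near: "x + s *\<^sub>R v + r *\<^sub>R w \<in> ball x d" if "0 \<le> s" "s \<le> h" "0 \<le> r" "r \<le> h" for s r
    proof -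
      have "norm (s *\<^sub>R v + r *\<^sub>R w) \<le> norm (s *\<^sub>R v) + norm (r *\<^sub>R w)"
        by (rule norm_triangle_ineq)
      also have "\<dots> \<le> h * norm v + h * norm w"
        using that by (intro add_mono) (auto intro!: mult_right_mono)
      also have "\<dots> \<le> h * (norm v + norm w + 1)"
        using h by (simp add: algebra_simps)
      also have "\<dots> = d / 2"
        unfolding h_def using add_nonneg_pos[of "norm v + norm w" 1] by (simp add: field_simps)
      also have "\<dots> < d" using d by simp
      finally show ?thesis
        by (metis add.assoc add_diff_cancel_left' dist_commute dist_norm mem_ball)
    qed
    have near': "x + s *\<^sub>R w + r *\<^sub>R v \<in> ball x d" if "0 \<le> s" "s \<le> h" "0 \<le> r" "r \<le> h" for s r
      using near[OF that(3,4,1,2)] by (simp add: algebra_simps)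
    obtain s r where sr: "0 \<le> s" "s \<le> h" "0 \<le> r" "r \<le> h"
      "f (x + h *\<^sub>R v + h *\<^sub>R w) - f (x + h *\<^sub>R v) - f (x + h *\<^sub>R w) + f x = h * h * ?a (x + s *\<^sub>R v + r *\<^sub>R w)"
      using second_difference[OF h, of x v w U f] near d(2) f fv by blast
    obtain s' r' where sr': "0 \<le> s'" "s' \<le> h" "0 \<le> r'" "r' \<le> h"
      "f (x + h *\<^sub>R w + h *\<^sub>R v) - f (x + h *\<^sub>R w) - f (x + h *\<^sub>R v) + f x = h * h * ?b (x + s' *\<^sub>R w + r' *\<^sub>R v)"
      using second_difference[OF h, of x w v U f] near' d(2) f fv by blast
    have "h * h * ?a (x + s *\<^sub>R v + r *\<^sub>R w) = h * h * ?b (x + s' *\<^sub>R w + r' *\<^sub>R v)"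
      using sr(5) sr'(5) by (simp add: algebra_simps)
    then have "?a (x + s *\<^sub>R v + r *\<^sub>R w) = ?b (x + s' *\<^sub>R w + r' *\<^sub>R v)"
      using h by simp
    then show ?thesis
      using d(3)[OF near[OF sr(1-4)]] d(4)[OF near'[OF sr'(1-4)]] by linarith
  qed
  then have "\<bar>?a x - ?b x\<bar> \<le> 0"
    using field_le_epsilon[of "\<bar>?a x - ?b x\<bar>" 0] by simp
  then show ?thesis by simp
qed

section \<open>Linear images and locality of C^k maps\<close>

lemma frechet_derivative_bounded_linear:
  assumes "bounded_linear L" "f differentiable (at x)"
  shows "frechet_derivative (\<lambda>y. L (f y)) (at x) = (\<lambda>v. L (frechet_derivative f (at x) v))"
  using bounded_linear.has_derivative[OF assms(1)] assms(2) frechet_derivative_at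
  unfolding frechet_derivative_works by metis

lemma differentiable_bounded_linear:
  assumes "bounded_linear L" "f differentiable F"
  shows "(\<lambda>y. L (f y)) differentiable F"
  using bounded_linear.has_derivative[OF assms(1)] assms(2) unfolding differentiable_def by blast

text \<open>A derivative at x depends only on the values near x, and U is a neighbourhood of each of
  its points; so the agreement passes to the derivatives, and induction applies.\<close>

lemma Ck_on_cong:
  assumes "open U" "\<And>x. x \<in> U \<Longrightarrow> f x = g x"
  shows "Ck_on k U f \<longleftrightarrow> Ck_on k U g"
  using assms
proof (induction k arbitrary: f g)
  case 0
  then show ?case by (auto intro: continuous_on_cong)
next
  case (Suc k)
  \<comment> \<open>\<open>frechet_derivative\<close> is a choice from the predicate
    \<open>has_derivative\<close>, so equivalence of the predicates gives equality of the chosen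
    maps.\<close>
  have eq: "(f has_derivative f') (at x) \<longleftrightarrow> (g has_derivative f') (at x)" if "x \<in> U" for x f'
    using has_derivative_transform_within_open[where f=f and g=g, OF _ \<open>open U\<close> that]
      has_derivative_transform_within_open[where f=g and g=f, OF _ \<open>open U\<close> that] Suc.prems(2)
    by metis
  then have "f differentiable (at x) \<longleftrightarrow> g differentiable (at x)" if "x \<in> U" for x
    unfolding differentiable_def using that by blast
  moreover have "frechet_derivative f (at x) = frechet_derivative g (at x)" if "x \<in> U" for x
    by (simp add: frechet_derivative_def eq[OF that])
  moreover from this have "Ck_on k U (\<lambda>x. frechet_derivative f (at x) v) \<longleftrightarrow>
      Ck_on k U (\<lambda>x. frechet_derivative g (at x) v)" for v
    by (intro Suc.IH[OF \<open>open U\<close>]) simp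
  ultimately show ?case
    by (simp only: Ck_on.simps cong: ball_cong)
qed

lemma Ck_on_subset:
  assumes "Ck_on k U f" "V \<subseteq> U"
  shows "Ck_on k V f"
  using assms(1)
proof (induction k arbitrary: f)
  case 0
  then show ?case
    using continuous_on_subset[OF _ assms(2)] by simp
next
  case (Suc k)
  then show ?case
    using assms(2) by auto
qed

lemma Ck_on_locally:
  assumes "\<And>x. x \<in> U \<Longrightarrow> \<exists>W. open W \<and> x \<in> W \<and> Ck_on k W f"
  shows "Ck_on k U f"
  using assms
proof (induction k arbitrary: f)
  case 0
  have "isCont f x" if "x \<in> U" for x
    using 0[OF that] by (auto simp: continuous_on_eq_continuous_at)
  then show ?case
    by (simp add: continuous_at_imp_continuous_on)
next
  case (Suc k)
  have "Ck_on k U (\<lambda>x. frechet_derivative f (at x) v)" for v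
  proof (rule Suc.IH)
    fix x assume "x \<in> U"
    then obtain W where "open W" "x \<in> W" "Ck_on (Suc k) W f"
      using Suc.prems by blast
    then show "\<exists>W. open W \<and> x \<in> W \<and> Ck_on k W (\<lambda>x. frechet_derivative f (at x) v)"
      by (intro exI[of _ W]) simp
  qed
  moreover have "f differentiable (at x)" if "x \<in> U" for x
    using Suc.prems[OF that] by auto
  ultimately show ?case by simp
qed

text \<open>Each local extension F agrees with f on the open set \<open>W \<inter> U\<close>, so f
  itself is of class C^k near each point.\<close>

lemma smooth_on_open_iff:
  assumes "open U"
  shows "smooth_on U f \<longleftrightarrow> (\<forall>k. Ck_on k U f)"
proof
  assume S: "smooth_on U f"
  show "\<forall>k. Ck_on k U f"
  proof (intro allI Ck_on_locally)
    fix k x assume "x \<in> U"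
    then obtain W F where W: "open W" "x \<in> W" "\<forall>k. Ck_on k W F" "\<forall>y\<in>W \<inter> U. F y = f y"
      using S unfolding smooth_on_def by blast
    have "open (W \<inter> U)" using W assms by blast
    moreover have "Ck_on k (W \<inter> U) F"
      using W Ck_on_subset by (metis inf_le1)
    ultimately have "Ck_on k (W \<inter> U) f"
      using Ck_on_cong[of "W \<inter> U" F f] W by blast
    then show "\<exists>W. open W \<and> x \<in> W \<and> Ck_on k W f"
      using \<open>open (W \<inter> U)\<close> \<open>x \<in> W\<close> \<open>x \<in> U\<close> by blast
  qed
next
  assume "\<forall>k. Ck_on k U f"
  then show "smooth_on U f"
    using assms unfolding smooth_on_def by blast
qed

lemma Ck_on_bounded_linear:
  assumes "open U" "bounded_linear L" "Ck_on k U f"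
  shows "Ck_on k U (\<lambda>x. L (f x))"
  using assms(3)
proof (induction k arbitrary: f)
  case 0
  then show ?case
    using bounded_linear.continuous_on[OF assms(2)] by auto
next
  case (Suc k)
  have "Ck_on k U (\<lambda>x. frechet_derivative (\<lambda>y. L (f y)) (at x) v)" for v
  proof -
    have "Ck_on k U (\<lambda>x. L (frechet_derivative f (at x) v))"
      using Suc by simp
    moreover have "frechet_derivative (\<lambda>y. L (f y)) (at x) v = L (frechet_derivative f (at x) v)"
      if "x \<in> U" for x
      by (subst frechet_derivative_bounded_linear[OF assms(2)]) (use Suc.prems that in auto)
    ultimately show ?thesis
      by (subst Ck_on_cong[OF assms(1)])
  qed
  then show ?case
    using Suc.prems differentiable_bounded_linear[OF assms(2)] by auto
qed

text \<open>Reduced to the real case by pairing with each basis vector b, an operation that is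
  linear and commutes with differentiation.\<close>

lemma frechet_derivative_commute:
  fixes f :: "'a::real_normed_vector \<Rightarrow> 'b::euclidean_space"
  assumes "open U" "Ck_on 2 U f" "x \<in> U"
  shows "frechet_derivative (\<lambda>y. frechet_derivative f (at y) v) (at x) w =
    frechet_derivative (\<lambda>y. frechet_derivative f (at y) w) (at x) v"
proof (rule euclidean_eqI)
  fix b :: 'b
  have L: "bounded_linear (\<lambda>y. y \<bullet> b)" by (rule bounded_linear_inner_left)
  have f: "f differentiable (at y)" if "y \<in> U" for y
    using assms that by (simp add: numeral_2_eq_2)
  have fv: "(\<lambda>y. frechet_derivative f (at y) v) differentiable (at y)" if "y \<in> U" for y v
    using assms that by (simp add: numeral_2_eq_2)
  have eq: "frechet_derivative (\<lambda>y. frechet_derivative (\<lambda>y. f y \<bullet> b) (at y) v) (at x) w =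
      frechet_derivative (\<lambda>y. frechet_derivative f (at y) v) (at x) w \<bullet> b" for v w
  proof -
    have "frechet_derivative (\<lambda>y. frechet_derivative f (at y) v \<bullet> b) (at x) =
        frechet_derivative (\<lambda>y. frechet_derivative (\<lambda>y. f y \<bullet> b) (at y) v) (at x)"
      by (rule frechet_derivative_transform_within_open[OF _ \<open>open U\<close> \<open>x \<in> U\<close>])
        (auto intro!: differentiable_bounded_linear[OF L] fv assms
          simp: frechet_derivative_bounded_linear[OF L f])
    then show ?thesis
      using frechet_derivative_bounded_linear[OF L fv[OF \<open>x \<in> U\<close>]] by metis
  qed
  show "frechet_derivative (\<lambda>y. frechet_derivative f (at y) v) (at x) w \<bullet> b =
      frechet_derivative (\<lambda>y. frechet_derivative f (at y) w) (at x) v \<bullet> b"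
    unfolding eq[symmetric]
    by (rule frechet_derivative_commute_real[OF assms(1) _ assms(3)])
      (rule Ck_on_bounded_linear[OF assms(1) L assms(2)])
qed

section \<open>Matrices and calculus in a chart\<close>

lemma bounded_bilinear_matrix_mult:
  "bounded_bilinear ((**) :: real^'n^'m \<Rightarrow> real^'l^'n \<Rightarrow> real^'l^'m)"
  unfolding bilinear_conv_bounded_bilinear[symmetric] bilinear_def
  by (auto intro!: linearI simp: matrix_add_ldistrib vec_eq_iff matrix_matrix_mult_def
      algebra_simps sum.distrib sum_distrib_left)

lemma bounded_bilinear_matrix_vector_mult:
  "bounded_bilinear ((*v) :: real^'n^'m \<Rightarrow> real^'n \<Rightarrow> real^'m)"
  unfolding bilinear_conv_bounded_bilinear[symmetric] bilinear_def
  by (auto intro!: linearI simp: vec_eq_iff matrix_vector_mult_def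
      algebra_simps sum.distrib sum_distrib_left)

lemma bounded_bilinear_vector_matrix_mult:
  "bounded_bilinear ((v*) :: real^'m \<Rightarrow> real^'n^'m \<Rightarrow> real^'n)"
  unfolding bilinear_conv_bounded_bilinear[symmetric] bilinear_def
  by (auto intro!: linearI simp: vec_eq_iff vector_matrix_mult_def
      algebra_simps sum.distrib sum_distrib_left)

lemma bounded_linear_transpose: "bounded_linear (transpose :: real^'n^'m \<Rightarrow> real^'m^'n)"
  unfolding linear_conv_bounded_linear[symmetric]
  by (auto intro!: linearI simp: transpose_def vec_eq_iff)

lemma has_derivative_vec_lambda:
  fixes f :: "'n::finite \<Rightarrow> 'a::real_normed_vector \<Rightarrow> 'b::euclidean_space"
  assumes "\<And>i. (f i has_derivative f' i) (at x within S)"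
  shows "((\<lambda>y. \<chi> i. f i y) has_derivative (\<lambda>y. \<chi> i. f' i y)) (at x within S)"
  unfolding has_derivative_componentwise_within[of "\<lambda>y. \<chi> i. f i y"]
  using assms by (auto simp: Basis_vec_def inner_axis intro!: has_derivative_inner_left)

lemma differentiable_vec_lambda:
  fixes f :: "'n::finite \<Rightarrow> 'a::real_normed_vector \<Rightarrow> 'b::euclidean_space"
  assumes "\<And>i. f i differentiable (at x within S)"
  shows "(\<lambda>y. \<chi> i. f i y) differentiable (at x within S)"
proof -
  obtain f' where f': "\<And>i. (f i has_derivative f' i) (at x within S)"
    using assms unfolding differentiable_def by metis
  show ?thesis
    unfolding differentiable_def by (rule exI, rule has_derivative_vec_lambda, rule f')
qed

section \<open>Determinants and inverse matrices as differentiable functions\<close>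

lemma bounded_linear_vec_nth_nth: "bounded_linear (\<lambda>T. T $ i $ j)"
  by (rule bounded_linear_compose[OF bounded_linear_vec_nth bounded_linear_vec_nth])

lemma differentiable_det:
  fixes M :: "'a::real_normed_vector \<Rightarrow> real^'n^'n"
  assumes "\<And>i j. (\<lambda>y. M y $ i $ j) differentiable (at x within S)"
  shows "(\<lambda>y. det (M y)) differentiable (at x within S)"
proof -
  have prod: "(\<lambda>y. \<Prod>i\<in>UNIV. M y $ i $ \<sigma> i) differentiable (at x within S)" for \<sigma>
  proof -
    have "\<forall>i. \<exists>D. ((\<lambda>y. M y $ i $ \<sigma> i) has_derivative D) (at x within S)"
      using assms unfolding differentiable_def by blast
    from choice[OF this] obtain f'
      where "\<forall>i. ((\<lambda>y. M y $ i $ \<sigma> i) has_derivative f' i) (at x within S)" ..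
    then have "((\<lambda>y. \<Prod>i\<in>UNIV. M y $ i $ \<sigma> i) has_derivative
        (\<lambda>y. \<Sum>i\<in>UNIV. f' i y * (\<Prod>j\<in>UNIV - {i}. M x $ j $ \<sigma> j))) (at x within S)"
      by (intro has_derivative_prod) simp
    then show ?thesis
      unfolding differentiable_def by blast
  qed
  show ?thesis
    unfolding det_def
    by (intro differentiable_sum ballI differentiable_mult prod differentiable_const) (simp add: finite_permutations)
qed

lemma matrix_inv_mult:
  fixes M :: "real^'n^'n"
  assumes "invertible M"
  shows "M ** matrix_inv M = mat 1" "matrix_inv M ** M = mat 1"
proof -
  have "M ** matrix_inv M = mat 1 \<and> matrix_inv M ** M = mat 1"
    using assms unfolding matrix_inv_def invertible_def by (rule someI_ex)
  then show "M ** matrix_inv M = mat 1" "matrix_inv M ** M = mat 1" by auto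
qed

text \<open>Cramer's rule for column l of the inverse. The entries become quotients of polynomials
  in the entries of M, which is where differentiability of the inverse comes from.\<close>

lemma matrix_inv_cramer:
  fixes M :: "real^'n^'n"
  assumes "invertible M"
  shows "matrix_inv M $ k $ l = det (\<chi> i j. if j = k then axis l 1 $ i else M $ i $ j) / det M"
proof -
  have "M *v (matrix_inv M *v axis l 1) = axis l 1"
    using matrix_inv_mult[OF assms] by (simp add: matrix_vector_mul_assoc)
  then have "(matrix_inv M *v axis l 1) $ k = det (\<chi> i j. if j = k then axis l 1 $ i else M $ i $ j) / det M"
    using cramer[of M] assms by (simp add: invertible_det_nz)
  then show ?thesis
    by (simp add: matrix_vector_mul_component inner_axis)
qed

text \<open>Stated within a set S because it serves both the open chart image and the time interval,
  where derivatives may be one-sided.\<close>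

lemma differentiable_matrix_inv:
  fixes M :: "'a::real_normed_vector \<Rightarrow> real^'n^'n"
  assumes M: "M differentiable (at x within S)" and x: "x \<in> S"
    and inv: "\<And>y. y \<in> S \<Longrightarrow> invertible (M y)"
  shows "(\<lambda>y. matrix_inv (M y)) differentiable (at x within S)"
proof -
  have Mij: "(\<lambda>y. M y $ i $ j) differentiable (at x within S)" for i j
    by (rule differentiable_bounded_linear[OF bounded_linear_vec_nth_nth M])
  have "(\<lambda>y. \<chi> k l. det (\<chi> i j. if j = k then axis l 1 $ i else M y $ i $ j) / det (M y))
      differentiable (at x within S)"
  proof (intro differentiable_vec_lambda differentiable_divide differentiable_det Mij)
    fix k l i j
    show "(\<lambda>y. (\<chi> i j. if j = k then axis l 1 $ i else M y $ i $ j) $ i $ j) differentiable (at x within S)"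
      by (cases "j = k") (simp_all add: Mij)
    show "det (M x) \<noteq> 0"
      using inv[OF x] by (simp add: invertible_det_nz)
  qed
  then show ?thesis
    by (rule differentiable_transform_within[OF _ zero_less_one x])
      (simp add: vec_eq_iff matrix_inv_cramer[OF inv])
qed

text \<open>Two levels of regularity are kept apart. \<open>smooth_in\<close> is carried only
  through linear maps and partial derivatives; products and the inverse metric are differentiated
  just once, for which \<open>diff_in\<close> suffices.\<close>

definition diff_in :: "('m, 'n::finite) chart \<Rightarrow> ('m \<Rightarrow> 'b::real_normed_vector) \<Rightarrow> bool" where
  "diff_in c f \<longleftrightarrow> (\<forall>p\<in>chart_dom c. (f \<circ> chart_inv c) differentiable (at (chart_map c p)))"

definition smooth_in :: "('m, 'n::finite) chart \<Rightarrow> ('m \<Rightarrow> 'b::real_normed_vector) \<Rightarrow> bool" where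
  "smooth_in c f \<longleftrightarrow> smooth_on (chart_img c) (f \<circ> chart_inv c)"

lemma diff_in_bounded_linear:
  assumes "bounded_linear L" "diff_in c f"
  shows "diff_in c (\<lambda>q. L (f q))"
  using assms(2) differentiable_bounded_linear[OF assms(1)]
  unfolding diff_in_def by (fastforce simp: o_def)

lemma diff_in_bilinear:
  assumes B: "bounded_bilinear B" and "diff_in c f" "diff_in c f'"
  shows "diff_in c (\<lambda>q. B (f q) (f' q))"
  using assms(2,3) bounded_bilinear.FDERIV[OF B]
  unfolding diff_in_def o_def differentiable_def by (fast)

lemma diff_in_const: "diff_in c (\<lambda>q. k)"
  by (simp add: diff_in_def o_def)

lemma diff_in_add:
  assumes "diff_in c f" "diff_in c f'"
  shows "diff_in c (\<lambda>q. f q + f' q)"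
  using assms by (simp add: diff_in_def o_def)

lemma diff_in_diff:
  assumes "diff_in c f" "diff_in c f'"
  shows "diff_in c (\<lambda>q. f q - f' q)"
  using assms by (simp add: diff_in_def o_def)

lemma diff_in_sum:
  assumes "\<And>a. a \<in> J \<Longrightarrow> diff_in c (f a)"
  shows "diff_in c (\<lambda>q. \<Sum>a\<in>J. f a q)"
  using assms by (induction J rule: infinite_finite_induct) (auto intro: diff_in_add diff_in_const)

lemma diff_in_vec_lambda:
  fixes f :: "'k::finite \<Rightarrow> 'm \<Rightarrow> 'b::euclidean_space"
  assumes "\<And>i. diff_in c (f i)"
  shows "diff_in c (\<lambda>q. \<chi> i. f i q)"
  using assms unfolding diff_in_def o_def by (intro ballI differentiable_vec_lambda) blast

lemma pd_eqI: "((f \<circ> chart_inv c) has_derivative f') (at (chart_map c p)) \<Longrightarrow> pd c i f p = f' (axis i 1)"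
  unfolding pd_def using frechet_derivative_at by metis

lemma diff_in_has_derivative:
  "diff_in c f \<Longrightarrow> p \<in> chart_dom c \<Longrightarrow>
    ((\<lambda>x. f (chart_inv c x)) has_derivative frechet_derivative (f \<circ> chart_inv c) (at (chart_map c p)))
      (at (chart_map c p))"
  unfolding diff_in_def frechet_derivative_works by (simp add: o_def)

lemma pd_bounded_linear:
  assumes "bounded_linear L" "diff_in c f" "p \<in> chart_dom c"
  shows "pd c i (\<lambda>q. L (f q)) p = L (pd c i f p)"
  using pd_eqI[of "\<lambda>q. L (f q)"] bounded_linear.has_derivative[OF assms(1) diff_in_has_derivative[OF assms(2,3)]]
  unfolding o_def pd_def by fastforce

lemma pd_const: "pd c i (\<lambda>q. k) p = 0"
  by (simp add: pd_def o_def)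

lemma pd_add:
  assumes "diff_in c f" "diff_in c f'" "p \<in> chart_dom c"
  shows "pd c i (\<lambda>q. f q + f' q) p = pd c i f p + pd c i f' p"
  by (rule pd_eqI[THEN trans])
    (auto simp: o_def pd_def intro!: derivative_eq_intros diff_in_has_derivative[unfolded o_def] assms)

lemma pd_diff:
  assumes "diff_in c f" "diff_in c f'" "p \<in> chart_dom c"
  shows "pd c i (\<lambda>q. f q - f' q) p = pd c i f p - pd c i f' p"
  by (rule pd_eqI[THEN trans])
    (auto simp: o_def pd_def intro!: derivative_eq_intros diff_in_has_derivative[unfolded o_def] assms)

lemma pd_sum:
  assumes "\<And>a. a \<in> J \<Longrightarrow> diff_in c (f a)" "p \<in> chart_dom c"
  shows "pd c i (\<lambda>q. \<Sum>a\<in>J. f a q) p = (\<Sum>a\<in>J. pd c i (f a) p)"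
  using assms
  by (induction J rule: infinite_finite_induct) (auto simp: pd_const pd_add diff_in_sum)

locale coordinate_chart =
  fixes c :: "('m, 'n::finite) chart"
  assumes open_img: "open (chart_img c)"
    and chart_inv_map: "p \<in> chart_dom c \<Longrightarrow> chart_inv c (chart_map c p) = p"
begin

lemma chart_map_inv: "x \<in> chart_img c \<Longrightarrow> chart_map c (chart_inv c x) = x"
  by (rule f_inv_into_f)

lemma chart_inv_dom: "x \<in> chart_img c \<Longrightarrow> chart_inv c x \<in> chart_dom c"
  by (rule inv_into_into)

lemma has_derivative_cong:
  assumes "\<And>q. q \<in> chart_dom c \<Longrightarrow> f q = f' q" "p \<in> chart_dom c"
    "((f \<circ> chart_inv c) has_derivative D) (at (chart_map c p))"
  shows "((f' \<circ> chart_inv c) has_derivative D) (at (chart_map c p))"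
  by (rule has_derivative_transform_within_open[OF assms(3) open_img]) (use assms chart_inv_dom in auto)

text \<open>The chart image is open, so \<open>pd\<close> at p sees only values on the chart domain.
  Most identities below hold only there, and this is how they are differentiated.\<close>

lemma pd_cong:
  assumes "\<And>q. q \<in> chart_dom c \<Longrightarrow> f q = f' q" "p \<in> chart_dom c"
  shows "pd c i f p = pd c i f' p"
proof -
  have "((f \<circ> chart_inv c) has_derivative D) (at (chart_map c p)) \<longleftrightarrow>
      ((f' \<circ> chart_inv c) has_derivative D) (at (chart_map c p))" for D
    using has_derivative_cong[of f f' p D] has_derivative_cong[of f' f p D] assms by metis
  then show ?thesis unfolding pd_def frechet_derivative_def by presburger
qed

lemma diff_in_cong:
  assumes "\<And>q. q \<in> chart_dom c \<Longrightarrow> f q = f' q" "diff_in c f"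
  shows "diff_in c f'"
  using assms has_derivative_cong[of f f'] unfolding diff_in_def differentiable_def by metis

lemma pd_bilinear:
  assumes B: "bounded_bilinear B" and f: "diff_in c f" "diff_in c f'" and p: "p \<in> chart_dom c"
  shows "pd c i (\<lambda>q. B (f q) (f' q)) p = B (pd c i f p) (f' p) + B (f p) (pd c i f' p)"
proof -
  have "((\<lambda>q. B (f q) (f' q)) \<circ> chart_inv c has_derivative
      (\<lambda>v. B (f p) (frechet_derivative (f' \<circ> chart_inv c) (at (chart_map c p)) v) +
           B (frechet_derivative (f \<circ> chart_inv c) (at (chart_map c p)) v) (f' p))) (at (chart_map c p))"
    using bounded_bilinear.FDERIV[OF B diff_in_has_derivative[OF f(1) p] diff_in_has_derivative[OF f(2) p]]
    by (simp add: o_def chart_inv_map[OF p])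
  from pd_eqI[OF this] show ?thesis
    by (simp add: pd_def add.commute)
qed

lemmas pd_mult = pd_bilinear[OF bounded_bilinear_mult]
lemmas pd_matrix_mult = pd_bilinear[OF bounded_bilinear_matrix_mult]
lemmas pd_matrix_vector_mult = pd_bilinear[OF bounded_bilinear_matrix_vector_mult]
lemmas pd_vector_matrix_mult = pd_bilinear[OF bounded_bilinear_vector_matrix_mult]

lemma smooth_in_Ck: "smooth_in c f \<longleftrightarrow> (\<forall>k. Ck_on k (chart_img c) (f \<circ> chart_inv c))"
  unfolding smooth_in_def by (rule smooth_on_open_iff[OF open_img])

lemma smooth_in_diff_in:
  assumes "smooth_in c f"
  shows "diff_in c f"
proof -
  have "Ck_on (Suc 0) (chart_img c) (f \<circ> chart_inv c)"
    using assms smooth_in_Ck by blast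
  then show ?thesis
    unfolding diff_in_def by auto
qed

lemma smooth_in_pd:
  assumes "smooth_in c f"
  shows "smooth_in c (pd c i f)"
  unfolding smooth_in_Ck
proof
  fix k
  have "Ck_on (Suc k) (chart_img c) (f \<circ> chart_inv c)"
    using assms smooth_in_Ck by blast
  then have "Ck_on k (chart_img c) (\<lambda>x. frechet_derivative (f \<circ> chart_inv c) (at x) (axis i 1))"
    by simp
  then show "Ck_on k (chart_img c) (pd c i f \<circ> chart_inv c)"
    by (subst Ck_on_cong[OF open_img]) (auto simp: pd_def chart_map_inv)
qed

lemma smooth_in_bounded_linear:
  assumes "bounded_linear L" "smooth_in c f"
  shows "smooth_in c (\<lambda>q. L (f q))"
  using Ck_on_bounded_linear[OF open_img assms(1)] assms(2)
  unfolding smooth_in_Ck by (fastforce simp: o_def)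

lemma pd_commute:
  fixes f :: "'m \<Rightarrow> 'b::euclidean_space"
  assumes "smooth_in c f" and p: "p \<in> chart_dom c"
  shows "pd c i (pd c j f) p = pd c j (pd c i f) p"
proof -
  let ?F = "f \<circ> chart_inv c"
  have ck: "Ck_on k (chart_img c) ?F" for k
    using assms smooth_in_Ck by blast
  have x: "chart_map c p \<in> chart_img c"
    using assms by blast
  have d: "(\<lambda>x. frechet_derivative ?F (at x) v) differentiable (at (chart_map c p))" for v
    using ck[of "Suc (Suc 0)"] p by simp
  have eq: "pd c i (pd c j f) p =
      frechet_derivative (\<lambda>x. frechet_derivative ?F (at x) (axis j 1)) (at (chart_map c p)) (axis i 1)" for i j
  proof -
    have "frechet_derivative (\<lambda>x. frechet_derivative ?F (at x) (axis j 1)) (at (chart_map c p)) =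
        frechet_derivative (pd c j f \<circ> chart_inv c) (at (chart_map c p))"
      by (rule frechet_derivative_transform_within_open[OF d open_img x]) (simp add: pd_def chart_map_inv)
    then show ?thesis by (simp add: pd_def)
  qed
  show ?thesis
    unfolding eq by (rule frechet_derivative_commute[OF open_img ck x])
qed

lemma diff_in_matrix_inv:
  fixes M :: "'m \<Rightarrow> real^'k^'k"
  assumes "diff_in c M" "\<And>q. q \<in> chart_dom c \<Longrightarrow> invertible (M q)"
  shows "diff_in c (\<lambda>q. matrix_inv (M q))"
  unfolding diff_in_def
proof
  fix p assume p: "p \<in> chart_dom c"
  have "(\<lambda>x. matrix_inv ((M \<circ> chart_inv c) x)) differentiable (at (chart_map c p) within chart_img c)"
  proof (rule differentiable_matrix_inv)
    show "(M \<circ> chart_inv c) differentiable (at (chart_map c p) within chart_img c)"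
      using assms(1) p unfolding diff_in_def by (simp add: differentiable_at_withinI)
    show "chart_map c p \<in> chart_img c"
      using p by blast
    show "invertible ((M \<circ> chart_inv c) x)" if "x \<in> chart_img c" for x
      using assms(2) chart_inv_dom[OF that] by simp
  qed
  then show "((\<lambda>q. matrix_inv (M q)) \<circ> chart_inv c) differentiable (at (chart_map c p))"
    using at_within_open[OF imageI[OF p] open_img] by (simp add: o_def)
qed

end

section \<open>The Levi-Civita connection in a chart\<close>

lemmas matrix_mult_simps =
  bounded_bilinear.add_left[OF bounded_bilinear_matrix_mult]
  bounded_bilinear.add_right[OF bounded_bilinear_matrix_mult]
  bounded_bilinear.diff_left[OF bounded_bilinear_matrix_mult]
  bounded_bilinear.diff_right[OF bounded_bilinear_matrix_mult]
  bounded_bilinear.minus_left[OF bounded_bilinear_matrix_mult]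
  bounded_bilinear.minus_right[OF bounded_bilinear_matrix_mult]

lemmas matrix_vector_simps =
  bounded_bilinear.add_left[OF bounded_bilinear_matrix_vector_mult]
  bounded_bilinear.add_right[OF bounded_bilinear_matrix_vector_mult]
  bounded_bilinear.diff_left[OF bounded_bilinear_matrix_vector_mult]
  bounded_bilinear.diff_right[OF bounded_bilinear_matrix_vector_mult]
  bounded_bilinear.minus_left[OF bounded_bilinear_matrix_vector_mult]
  bounded_bilinear.minus_right[OF bounded_bilinear_matrix_vector_mult]
  bounded_bilinear.scaleR_left[OF bounded_bilinear_matrix_vector_mult]
  bounded_bilinear.scaleR_right[OF bounded_bilinear_matrix_vector_mult]

lemmas vector_matrix_simps =
  bounded_bilinear.add_left[OF bounded_bilinear_vector_matrix_mult]
  bounded_bilinear.add_right[OF bounded_bilinear_vector_matrix_mult]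
  bounded_bilinear.diff_left[OF bounded_bilinear_vector_matrix_mult]
  bounded_bilinear.diff_right[OF bounded_bilinear_vector_matrix_mult]
  bounded_bilinear.minus_left[OF bounded_bilinear_vector_matrix_mult]
  bounded_bilinear.minus_right[OF bounded_bilinear_vector_matrix_mult]
  bounded_bilinear.scaleR_left[OF bounded_bilinear_vector_matrix_mult]
  bounded_bilinear.scaleR_right[OF bounded_bilinear_vector_matrix_mult]

lemma matrix_vector_mult_axis: "(M *v axis j 1) $ k = (M :: real^'n^'m) $ k $ j"
  by (simp add: matrix_vector_mul_component inner_axis)

lemma transpose_add: "transpose (M + N) = transpose M + transpose (N :: real^'n^'m)"
  and transpose_diff: "transpose (M - N) = transpose M - transpose (N :: real^'n^'m)"
  by (simp_all add: transpose_def vec_eq_iff)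

lemma invertible_positive_definite:
  fixes M :: "real^'n^'n"
  assumes "\<And>v. v \<noteq> 0 \<Longrightarrow> v \<bullet> (M *v v) > 0"
  shows "invertible M"
proof -
  have "v = 0" if "M *v v = 0" for v
    using assms[of v] that by auto
  then show ?thesis
    unfolding invertible_left_inverse matrix_left_invertible_ker by blast
qed

lemma transpose_matrix_inv:
  fixes M :: "real^'n^'n"
  assumes "invertible M" "transpose M = M"
  shows "transpose (matrix_inv M) = matrix_inv M"
proof -
  have "transpose (matrix_inv M) ** M = mat 1"
    using arg_cong[OF matrix_inv_mult(1)[OF assms(1)], of transpose] assms(2)
    by (simp add: matrix_transpose_mul)
  then have "transpose (matrix_inv M) ** (M ** matrix_inv M) = matrix_inv M"
    by (simp add: matrix_mul_assoc)
  then show ?thesis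
    using matrix_inv_mult(1)[OF assms(1)] by simp
qed

lemma dir_deriv_coord_field: "dir_deriv c (coord_field i) f = pd c i f"
proof
  fix p
  have "dir_deriv c (coord_field i) f p = (\<Sum>j\<in>UNIV. if j = i then pd c j f p else 0)"
    unfolding dir_deriv_def coord_field_def by (rule sum.cong) (auto simp: axis_def)
  then show "dir_deriv c (coord_field i) f p = pd c i f p" by simp
qed

locale riemannian_chart = coordinate_chart c
  for c :: "('m, 'n::finite) chart" +
  fixes g :: "('m, 'n) tensor2" and G :: "('m, 'n) tensor3"
  assumes g_smooth: "smooth_in c (g c)"
    and g_sym: "p \<in> chart_dom c \<Longrightarrow> transpose (g c p) = g c p"
    and g_pos: "p \<in> chart_dom c \<Longrightarrow> v \<noteq> 0 \<Longrightarrow> v \<bullet> (g c p *v v) > 0"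
    and G_smooth: "smooth_in c (G c)"
    and torsion_free: "p \<in> chart_dom c \<Longrightarrow> G c p $ k $ i $ j = G c p $ k $ j $ i"
    and metric_compatible: "p \<in> chart_dom c \<Longrightarrow> pd c k (\<lambda>q. g c q $ i $ j) p =
      (\<Sum>l\<in>UNIV. G c p $ l $ k $ i * g c p $ l $ j + G c p $ l $ k $ j * g c p $ i $ l)"
begin

abbreviation h :: "'m \<Rightarrow> real^'n^'n" where
  "h p \<equiv> matrix_inv (g c p)"

text \<open>Row index k and column index j, so that \<open>Gam i p *v Z p\<close> is the zeroth
  order part of D_i on a vector field Z, and minus \<open>w p v* Gam i p\<close> that on a covector
  field w.\<close>

definition Gam :: "'n \<Rightarrow> 'm \<Rightarrow> real^'n^'n" where
  "Gam i p = (\<chi> k j. G c p $ k $ i $ j)"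

text \<open>The curvature d Gam + Gam wedge Gam of the connection form. Its entry in row m and
  column j is the component m of R(e_i, e_l) e_j.\<close>

definition Curv :: "'n \<Rightarrow> 'n \<Rightarrow> 'm \<Rightarrow> real^'n^'n" where
  "Curv i l p = pd c i (Gam l) p - pd c l (Gam i) p + Gam i p ** Gam l p - Gam l p ** Gam i p"

lemma g_invertible: "p \<in> chart_dom c \<Longrightarrow> invertible (g c p)"
  by (rule invertible_positive_definite[OF g_pos])

lemmas g_h = matrix_inv_mult(1)[OF g_invertible]
lemmas h_g = matrix_inv_mult(2)[OF g_invertible]

lemma h_sym: "p \<in> chart_dom c \<Longrightarrow> transpose (h p) = h p"
  by (rule transpose_matrix_inv[OF g_invertible g_sym])

lemma h_sym_nth: "p \<in> chart_dom c \<Longrightarrow> h p $ i $ j = h p $ j $ i"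
  using h_sym by (metis (no_types, lifting) transpose_def vec_lambda_beta)

lemma diff_g: "diff_in c (g c)"
  by (rule smooth_in_diff_in[OF g_smooth])

lemma diff_h: "diff_in c h"
  by (rule diff_in_matrix_inv[OF diff_g g_invertible])

lemma Gam_smooth: "smooth_in c (Gam i)"
proof -
  have "bounded_linear (\<lambda>T::real^'n^'n^'n. \<chi> k j. T $ k $ i $ j)"
    unfolding linear_conv_bounded_linear[symmetric] by (auto intro!: linearI simp: vec_eq_iff)
  from smooth_in_bounded_linear[OF this G_smooth] show ?thesis
    by (simp add: Gam_def[abs_def])
qed

lemma diff_Gam: "diff_in c (Gam i)"
  by (rule smooth_in_diff_in[OF Gam_smooth])

lemma Gam_sym: "p \<in> chart_dom c \<Longrightarrow> Gam i p $ k $ j = Gam j p $ k $ i"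
  using torsion_free by (simp add: Gam_def)

lemma pd_nth_nth: "diff_in c M \<Longrightarrow> p \<in> chart_dom c \<Longrightarrow> pd c i M p $ k $ j = pd c i (\<lambda>q. M q $ k $ j) p"
  using pd_bounded_linear[OF bounded_linear_vec_nth_nth, of c M p i k j] by simp

lemma pd_nth: "diff_in c M \<Longrightarrow> p \<in> chart_dom c \<Longrightarrow> pd c i M p $ k = pd c i (\<lambda>q. M q $ k) p"
  using pd_bounded_linear[OF bounded_linear_vec_nth, of c M p i k] by simp

lemma pd_Gam_sym: "p \<in> chart_dom c \<Longrightarrow> pd c l (Gam i) p $ k $ j = pd c l (Gam j) p $ k $ i"
  unfolding pd_nth_nth[OF diff_Gam] by (rule pd_cong[OF Gam_sym])

lemma pd_g: 
  assumes p: "p \<in> chart_dom c"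
  shows "pd c k (g c) p = transpose (Gam k p) ** g c p + g c p ** Gam k p"
  using metric_compatible[OF p]
  by (simp add: vec_eq_iff pd_nth_nth[OF diff_g p] matrix_matrix_mult_def transpose_def Gam_def sum.distrib
      mult.commute)

text \<open>Differentiate h g = 1 and substitute D g = 0 in the form \<open>pd_g\<close>; the result
  expresses D h = 0.\<close>

lemma pd_h:
  assumes p: "p \<in> chart_dom c"
  shows "pd c k h p = - (h p ** transpose (Gam k p)) - Gam k p ** h p"
proof -
  have "pd c k (\<lambda>q. h q ** g c q) p = 0"
    using pd_cong[of "\<lambda>q. h q ** g c q" "\<lambda>q. mat 1" p k] h_g p by (simp add: pd_const)
  then have "pd c k h p ** g c p + h p ** pd c k (g c) p = 0"
    using pd_matrix_mult[OF diff_h diff_g p] by simp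
  then have "pd c k h p ** g c p = - (h p ** pd c k (g c) p)"
    by (simp only: eq_neg_iff_add_eq_0)
  then have "(pd c k h p ** g c p) ** h p = - (h p ** pd c k (g c) p) ** h p"
    by (rule arg_cong)
  then have "pd c k h p ** (g c p ** h p) = - (h p ** transpose (Gam k p) ** (g c p ** h p)) - (h p ** g c p) ** Gam k p ** h p"
    unfolding pd_g[OF p] by (simp add: matrix_mult_simps matrix_mul_assoc)
  then show ?thesis
    using g_h[OF p] h_g[OF p] by simp
qed

text \<open>By D h = 0 the derivative of h yields one term that cancels \<open>Gam i p\<close>
  acting on the vector and one that completes the covariant derivative of the covector w.\<close>

lemma cov_sharp:
  assumes w: "diff_in c w" and p: "p \<in> chart_dom c"
  shows "pd c i (\<lambda>q. h q *v w q) p + Gam i p *v (h p *v w p) = h p *v (pd c i w p - w p v* Gam i p)"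
  unfolding pd_matrix_vector_mult[OF diff_h w p] pd_h[OF p]
  by (simp add: matrix_vector_simps flip: matrix_vector_mul_assoc)

text \<open>Second partial derivatives of g commute. When both orders are expanded by
  \<open>pd_g\<close>, the terms with g between two factors Gam cancel and the rest assembles to
  curvature.\<close>

lemma Curv_skew:
  assumes p: "p \<in> chart_dom c"
  shows "transpose (Curv i l p) ** g c p + g c p ** Curv i l p = 0"
proof -
  have ddg: "pd c i (pd c l (g c)) p =
      transpose (pd c i (Gam l) p) ** g c p
      + transpose (Gam l p) ** (transpose (Gam i p) ** g c p + g c p ** Gam i p)
      + ((transpose (Gam i p) ** g c p + g c p ** Gam i p) ** Gam l p + g c p ** pd c i (Gam l) p)" for i l
  proof -
    have t: "diff_in c (\<lambda>q. transpose (Gam l q))"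
      by (rule diff_in_bounded_linear[OF bounded_linear_transpose diff_Gam])
    have "pd c i (pd c l (g c)) p = pd c i (\<lambda>q. transpose (Gam l q) ** g c q + g c q ** Gam l q) p"
      by (rule pd_cong[OF pd_g p])
    also have "\<dots> = pd c i (\<lambda>q. transpose (Gam l q) ** g c q) p + pd c i (\<lambda>q. g c q ** Gam l q) p"
      by (intro pd_add diff_in_bilinear[OF bounded_bilinear_matrix_mult] t diff_g diff_Gam p)
    finally show ?thesis
      unfolding pd_matrix_mult[OF t diff_g p] pd_matrix_mult[OF diff_g diff_Gam p]
        pd_bounded_linear[OF bounded_linear_transpose diff_Gam p] pd_g[OF p] .
  qed
  have "pd c i (pd c l (g c)) p - pd c l (pd c i (g c)) p = 0"
    using pd_commute[OF g_smooth p] by simp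
  then show ?thesis
    unfolding ddg Curv_def
    by (simp add: transpose_add transpose_diff matrix_transpose_mul matrix_mult_simps matrix_mul_assoc
        algebra_simps)
qed

lemma Curv_h:
  assumes p: "p \<in> chart_dom c"
  shows "Curv i l p ** h p = - (h p ** transpose (Curv i l p))"
proof -
  have "h p ** (transpose (Curv i l p) ** g c p + g c p ** Curv i l p) ** h p = 0"
    using Curv_skew[OF p] by (simp add: matrix_matrix_mult_def zero_vec_def)
  then have "h p ** transpose (Curv i l p) ** (g c p ** h p) + (h p ** g c p) ** Curv i l p ** h p = 0"
    by (simp add: matrix_mult_simps matrix_mul_assoc)
  then show ?thesis
    using g_h[OF p] h_g[OF p] by (simp add: eq_neg_iff_add_eq_0 add.commute)
qed

text \<open>By skewness the matrix is minus h R^T g, whose trace is minus that of R because g h = 1;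
  so the trace equals its own negative. It is the middle term of the contracted Bianchi
  identity.\<close>

lemma trace_Curv:
  assumes p: "p \<in> chart_dom c"
  shows "trace (Curv i l p) = 0"
proof -
  have "Curv i l p = (Curv i l p ** h p) ** g c p"
    using h_g[OF p] by (simp flip: matrix_mul_assoc)
  also have "\<dots> = - ((h p ** transpose (Curv i l p)) ** g c p)"
    unfolding Curv_h[OF p] by (simp add: matrix_mult_simps)
  finally have "trace (Curv i l p) = trace (- ((h p ** transpose (Curv i l p)) ** g c p))"
    by (rule arg_cong)
  also have "\<dots> = - trace ((h p ** transpose (Curv i l p)) ** g c p)"
    by (simp add: trace_def sum_negf)
  also have "\<dots> = - trace (g c p ** (h p ** transpose (Curv i l p)))"
    by (subst trace_mul_sym) (rule refl)
  also have "\<dots> = - trace (transpose (Curv i l p))"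
    using g_h[OF p] by (simp add: matrix_mul_assoc)
  also have "\<dots> = - trace (Curv i l p)"
    by (simp add: trace_def transpose_def)
  finally show ?thesis by simp
qed

text \<open>Torsion-freeness exchanges the direction index of Gam with its column index; then the
  derivative terms and the products cancel in pairs.\<close>

lemma bianchi:
  assumes p: "p \<in> chart_dom c"
  shows "Curv i l p $ m $ j + Curv l j p $ m $ i + Curv j i p $ m $ l = 0"
proof -
  have mm: "(Gam i p ** Gam l p) $ m $ j = (Gam i p ** Gam j p) $ m $ l" for i j l
    by (simp add: matrix_matrix_mult_def Gam_sym[OF p, of l _ j])
  show ?thesis
    using pd_Gam_sym[OF p, of i l m j] pd_Gam_sym[OF p, of l i m j] pd_Gam_sym[OF p, of j i m l]
      mm[of i l j] mm[of l i j] mm[of j i l]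
    by (simp add: Curv_def)
qed

lemma Curv_anti: "Curv i l p = - Curv l i p"
  by (simp add: Curv_def)

section \<open>Curvature and Ricci tensor on coordinate fields\<close>

lemma cov_deriv_coord_field: "cov_deriv G c (coord_field i) Z p = pd c i Z p + Gam i p *v Z p"
proof -
  have "(\<Sum>a\<in>UNIV. \<Sum>j\<in>UNIV. G c p $ k $ a $ j * axis i 1 $ a * Z p $ j) =
      (\<Sum>a\<in>UNIV. if a = i then \<Sum>j\<in>UNIV. G c p $ k $ i $ j * Z p $ j else 0)" for k
    by (rule sum.cong) (auto simp: axis_def)
  then show ?thesis
    unfolding cov_deriv_def dir_deriv_coord_field
    by (simp add: vec_eq_iff matrix_vector_mult_def Gam_def coord_field_def)
qed

lemma cov_deriv_coord_fields: "cov_deriv G c (coord_field i) (coord_field j) p = Gam i p *v axis j 1"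
  unfolding cov_deriv_coord_field by (simp add: coord_field_def pd_const)

lemma riemann_coord_fields:
  assumes p: "p \<in> chart_dom c"
  shows "riemann G c (coord_field i) (coord_field l) (coord_field j) p $ m = Curv i l p $ m $ j"
proof -
  have 1: "cov_deriv G c (coord_field i) (cov_deriv G c (coord_field l) (coord_field j)) p =
      pd c i (Gam l) p *v axis j 1 + Gam i p *v (Gam l p *v axis j 1)" for i l
  proof -
    have "cov_deriv G c (coord_field l) (coord_field j) = (\<lambda>q. Gam l q *v axis j 1)"
      by (rule ext) (rule cov_deriv_coord_fields)
    moreover have "pd c i (\<lambda>q. Gam l q *v axis j 1) p = pd c i (Gam l) p *v axis j 1"
      using pd_matrix_vector_mult[OF diff_Gam diff_in_const p] by (simp add: pd_const)
    ultimately show ?thesis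
      by (simp add: cov_deriv_coord_field[where Z="\<lambda>q. Gam l q *v axis j 1"])
  qed
  have "lie_bracket c (coord_field i) (coord_field l) = (\<lambda>q. 0)"
    by (rule ext) (simp add: lie_bracket_def dir_deriv_coord_field, simp add: coord_field_def pd_const)
  then have 2: "cov_deriv G c (lie_bracket c (coord_field i) (coord_field l)) (coord_field j) p = 0"
    by (simp add: cov_deriv_def dir_deriv_def vec_eq_iff)
  show ?thesis
    unfolding riemann_def 1 2
    by (simp add: Curv_def matrix_vector_mul_assoc matrix_vector_mult_axis)
qed

lemma ricci_Curv: "p \<in> chart_dom c \<Longrightarrow> ricci G c p $ j $ k = (\<Sum>i\<in>UNIV. Curv i j p $ i $ k)"
  by (simp add: ricci_def riemann_coord_fields)

text \<open>Contraction of the Bianchi identity: the middle term is a trace of the curvature and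
  vanishes, the last one is Ricci with its arguments exchanged and the opposite sign.\<close>

lemma ricci_sym:
  assumes p: "p \<in> chart_dom c"
  shows "ricci G c p $ j $ k = ricci G c p $ k $ j"
proof -
  have "0 = (\<Sum>i\<in>UNIV. Curv i j p $ i $ k + Curv j k p $ i $ i + Curv k i p $ i $ j)"
    using bianchi[OF p] by simp
  also have "\<dots> = ricci G c p $ j $ k + trace (Curv j k p) - ricci G c p $ k $ j"
    unfolding ricci_Curv[OF p] sum.distrib trace_def
    by (subst (3) Curv_anti) (simp add: sum_negf)
  finally show ?thesis
    using trace_Curv[OF p] by simp
qed

end

section \<open>The Bochner formula\<close>

locale riemannian_chart_function = riemannian_chart c g G
  for c :: "('m, 'n::finite) chart" and g G +
  fixes u :: "'m \<Rightarrow> real"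
  assumes u_smooth: "smooth_in c u"
begin

definition du :: "'m \<Rightarrow> real^'n" where
  "du q = (\<chi> i. pd c i u q)"

definition hess :: "'n \<Rightarrow> 'm \<Rightarrow> real^'n" where
  "hess j q = pd c j du q - du q v* Gam j q"

text \<open>D_hess i j is the covector of components D_i D_j D_l u.\<close>

definition D_hess :: "'n \<Rightarrow> 'n \<Rightarrow> 'm \<Rightarrow> real^'n" where
  "D_hess i j p = pd c i (hess j) p - hess j p v* Gam i p - (\<Sum>m\<in>UNIV. Gam i p $ m $ j *\<^sub>R hess m p)"

lemma grad_eq: "grad g u c = (\<lambda>q. h q *v du q)"
  by (simp add: fun_eq_iff grad_def sharp_def du_def)

lemma diff_pd_u: "diff_in c (pd c i u)"
  by (intro smooth_in_diff_in smooth_in_pd u_smooth)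

lemma diff_du: "diff_in c du"
  unfolding du_def[abs_def] by (rule diff_in_vec_lambda[OF diff_pd_u])

lemma pd_du: "p \<in> chart_dom c \<Longrightarrow> pd c j du p = (\<chi> l. pd c j (pd c l u) p)"
  using pd_nth[OF diff_du] by (simp add: vec_eq_iff du_def)

lemma diff_pd_du: "diff_in c (pd c j du)"
proof (rule diff_in_cong)
  show "diff_in c (\<lambda>q. \<chi> l. pd c j (pd c l u) q)"
    by (intro diff_in_vec_lambda smooth_in_diff_in smooth_in_pd u_smooth)
qed (simp add: pd_du)

lemma pd_pd_du:
  assumes p: "p \<in> chart_dom c"
  shows "pd c i (pd c j du) p = pd c j (pd c i du) p"
proof -
  have "pd c i (pd c j du) p $ l = pd c i (pd c j (pd c l u)) p" for i j l
  proof -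
    have "pd c i (pd c j du) p $ l = pd c i (\<lambda>q. pd c j du q $ l) p"
      by (rule pd_nth[OF diff_pd_du p])
    also have "\<dots> = pd c i (pd c j (pd c l u)) p"
      by (rule pd_cong[OF _ p]) (simp add: pd_du)
    finally show ?thesis .
  qed
  then show ?thesis
    using pd_commute[OF smooth_in_pd[OF u_smooth] p] by (simp add: vec_eq_iff)
qed

lemma hess_sym: "p \<in> chart_dom c \<Longrightarrow> hess i p $ j = hess j p $ i"
  using pd_commute[OF u_smooth, of p i j]
  by (simp add: hess_def pd_du vector_matrix_mult_def Gam_sym[of p i _ j])

lemma diff_hess: "diff_in c (hess j)"
  unfolding hess_def[abs_def]
  by (intro diff_in_diff diff_pd_du diff_in_bilinear[OF bounded_bilinear_vector_matrix_mult] diff_du diff_Gam)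

lemma pd_hess:
  assumes p: "p \<in> chart_dom c"
  shows "pd c i (hess j) p = pd c i (pd c j du) p - pd c i du p v* Gam j p - du p v* pd c i (Gam j) p"
proof -
  have "pd c i (hess j) p = pd c i (pd c j du) p - pd c i (\<lambda>q. du q v* Gam j q) p"
    unfolding hess_def[abs_def]
    by (intro pd_diff diff_pd_du diff_in_bilinear[OF bounded_bilinear_vector_matrix_mult] diff_du diff_Gam p)
  then show ?thesis
    using pd_vector_matrix_mult[OF diff_du diff_Gam p] by simp
qed

text \<open>Symmetry of the Hessian is inherited by its covariant derivative; the connection
  corrections for the slots j and l change places.\<close>

lemma D_hess_sym:
  assumes p: "p \<in> chart_dom c"
  shows "D_hess i j p $ l = D_hess i l p $ j"
proof -
  have "pd c i (hess j) p $ l = pd c i (hess l) p $ j"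
    unfolding pd_nth[OF diff_hess p] by (rule pd_cong[OF hess_sym p])
  moreover have "(hess j p v* Gam i p) $ l = (\<Sum>m\<in>UNIV. Gam i p $ m $ l *\<^sub>R hess m p) $ j" for j l
    by (simp add: vector_matrix_mult_def sum_component hess_sym[OF p, of j] mult.commute)
  ultimately show ?thesis
    by (simp add: D_hess_def)
qed

text \<open>The iterated partial derivatives of du commute, and the corrections for the exchanged
  pair i, l agree by torsion-freeness; what remains is the curvature acting on the covector
  du.\<close>

lemma ricci_identity:
  assumes p: "p \<in> chart_dom c"
  shows "D_hess i l p - D_hess l i p = - (du p v* Curv i l p)"
proof -
  have "(\<Sum>m\<in>UNIV. Gam i p $ m $ l *\<^sub>R hess m p) = (\<Sum>m\<in>UNIV. Gam l p $ m $ i *\<^sub>R hess m p)"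
    by (simp add: Gam_sym[OF p, of i _ l])
  then have "D_hess i l p - D_hess l i p = pd c i (hess l) p - hess l p v* Gam i p
      - (pd c l (hess i) p - hess i p v* Gam l p)"
    by (simp add: D_hess_def)
  also have "\<dots> = - (du p v* Curv i l p)"
    unfolding pd_hess[OF p] pd_pd_du[OF p, of i l]
    by (simp add: hess_def Curv_def vector_matrix_simps vector_matrix_mul_assoc algebra_simps)
  finally show ?thesis .
qed

section \<open>The Laplacian of u and its differential\<close>

definition lap :: "'m \<Rightarrow> real" where
  "lap q = (\<Sum>i\<in>UNIV. \<Sum>j\<in>UNIV. h q $ i $ j * hess i q $ j)"

lemma laplacian_fun_eq:
  assumes p: "p \<in> chart_dom c"
  shows "laplacian_fun g c (cov_deriv G c) u p = lap p"
  using pd_du[OF p]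
  by (simp add: laplacian_fun_def metric_trace_def lap_def dir_deriv_coord_field hess_def
    dir_deriv_def[of c "cov_deriv G c _ _"] cov_deriv_coord_fields matrix_vector_mult_axis
    vector_matrix_mult_def du_def mult.commute)

text \<open>D h = 0 lets the trace pass through D: the two terms of \<open>pd_h\<close> supply
  exactly the two connection corrections in \<open>D_hess\<close>.\<close>

lemma pd_lap:
  assumes p: "p \<in> chart_dom c"
  shows "pd c l lap p = (\<Sum>i\<in>UNIV. \<Sum>j\<in>UNIV. h p $ i $ j * D_hess l i p $ j)"
proof -
  have dh: "diff_in c (\<lambda>q. h q $ i $ j)" for i j
    by (rule diff_in_bounded_linear[OF bounded_linear_vec_nth_nth diff_h])
  have dH: "diff_in c (\<lambda>q. hess i q $ j)" for i j
    by (rule diff_in_bounded_linear[OF bounded_linear_vec_nth diff_hess])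
  have "pd c l lap p = (\<Sum>i\<in>UNIV. \<Sum>j\<in>UNIV. pd c l (\<lambda>q. h q $ i $ j * hess i q $ j) p)"
    unfolding lap_def[abs_def]
    by (simp add: pd_sum diff_in_sum diff_in_bilinear[OF bounded_bilinear_mult] dh dH p)
  also have "\<dots> = (\<Sum>i\<in>UNIV. \<Sum>j\<in>UNIV. pd c l h p $ i $ j * hess i p $ j + h p $ i $ j * pd c l (hess i) p $ j)"
    by (simp add: pd_mult[OF dh dH p] pd_nth_nth[OF diff_h p] pd_nth[OF diff_hess p])
  also have "\<dots> = (\<Sum>i\<in>UNIV. \<Sum>j\<in>UNIV. h p $ i $ j * pd c l (hess i) p $ j)
      - (\<Sum>i\<in>UNIV. \<Sum>j\<in>UNIV. \<Sum>m\<in>UNIV. h p $ i $ m * Gam l p $ j $ m * hess i p $ j)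
      - (\<Sum>i\<in>UNIV. \<Sum>j\<in>UNIV. \<Sum>m\<in>UNIV. Gam l p $ i $ m * h p $ m $ j * hess i p $ j)"
    unfolding pd_h[OF p]
    by (simp add: matrix_matrix_mult_def transpose_def sum.distrib sum_subtractf sum_distrib_right
        left_diff_distrib sum_negf)
  also have "(\<Sum>i\<in>UNIV. \<Sum>j\<in>UNIV. \<Sum>m\<in>UNIV. h p $ i $ m * Gam l p $ j $ m * hess i p $ j) =
      (\<Sum>i\<in>UNIV. \<Sum>j\<in>UNIV. h p $ i $ j * (hess i p v* Gam l p) $ j)"
    by (rule sum.cong[OF refl], subst sum.swap)
      (simp add: vector_matrix_mult_def sum_distrib_left ac_simps)
  also have "(\<Sum>i\<in>UNIV. \<Sum>j\<in>UNIV. \<Sum>m\<in>UNIV. Gam l p $ i $ m * h p $ m $ j * hess i p $ j) =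
      (\<Sum>m\<in>UNIV. \<Sum>j\<in>UNIV. \<Sum>i\<in>UNIV. Gam l p $ i $ m * h p $ m $ j * hess i p $ j)"
    by (subst (2) sum.swap, subst sum.swap, subst (2) sum.swap) (rule refl)
  also have "\<dots> = (\<Sum>i\<in>UNIV. \<Sum>j\<in>UNIV. h p $ i $ j * (\<Sum>m\<in>UNIV. Gam l p $ m $ i *\<^sub>R hess m p) $ j)"
    by (simp add: sum_component sum_distrib_left mult.assoc mult.left_commute)
  finally show ?thesis
    by (simp add: D_hess_def right_diff_distrib sum_subtractf)
qed

text \<open>Symmetry of \<open>D_hess\<close> in its last two slots and the Ricci identity turn D_i
  D_j D_l u, under the trace over i and j, into D_l D_i D_j u plus curvature; the first part traces
  to the differential of the Laplacian.\<close>

lemma bochner: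
  assumes p: "p \<in> chart_dom c"
  shows "(\<Sum>i\<in>UNIV. \<Sum>j\<in>UNIV. h p $ i $ j *\<^sub>R D_hess i j p) =
    (\<chi> l. pd c l lap p) + (h p *v du p) v* ricci G c p"
proof -
  have "(\<Sum>i\<in>UNIV. \<Sum>j\<in>UNIV. h p $ i $ j * D_hess i j p $ l) =
      pd c l lap p + ((h p *v du p) v* ricci G c p) $ l" for l
  proof -
    \<comment> \<open>\<open>v*\<close> feeds the gradient into the first slot of Ricci, whereas the
      contraction below produces it in the second; hence the appeal to symmetry.\<close>
    have ric: "ricci G c p $ j $ l = (\<Sum>i\<in>UNIV. Curv i l p $ i $ j)" for j
      unfolding ricci_sym[OF p, of j l] by (rule ricci_Curv[OF p])
    \<comment> \<open>Skewness of the curvature exchanges the free index m with the direction i; its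
      sign is what makes Ricci appear with a plus.\<close>
    have Rh: "(\<Sum>j\<in>UNIV. h p $ i $ j * Curv i l p $ m $ j) = - (\<Sum>j\<in>UNIV. h p $ m $ j * Curv i l p $ i $ j)" for i m
    proof -
      have "(Curv i l p ** h p) $ m $ i = - (h p ** transpose (Curv i l p)) $ m $ i"
        using Curv_h[OF p] by simp
      then show ?thesis
        by (simp add: matrix_matrix_mult_def transpose_def h_sym_nth[OF p, of _ i] mult.commute)
    qed
    have "(\<Sum>i\<in>UNIV. \<Sum>j\<in>UNIV. h p $ i $ j * D_hess i j p $ l) - pd c l lap p =
        (\<Sum>i\<in>UNIV. \<Sum>j\<in>UNIV. h p $ i $ j * (D_hess i l p - D_hess l i p) $ j)"
      unfolding pd_lap[OF p] by (simp add: D_hess_sym[OF p, of _ _ l] sum_subtractf right_diff_distrib)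
    also have "\<dots> = - (\<Sum>i\<in>UNIV. \<Sum>j\<in>UNIV. \<Sum>m\<in>UNIV. h p $ i $ j * Curv i l p $ m $ j * du p $ m)"
      unfolding ricci_identity[OF p]
      by (simp add: vector_matrix_mult_def sum_distrib_left sum_negf ac_simps)
    also have "\<dots> = - (\<Sum>i\<in>UNIV. \<Sum>m\<in>UNIV. (\<Sum>j\<in>UNIV. h p $ i $ j * Curv i l p $ m $ j) * du p $ m)"
      unfolding sum_distrib_right
      by (rule arg_cong[where f=uminus], rule sum.cong[OF refl], rule sum.swap)
    also have "\<dots> = (\<Sum>i\<in>UNIV. \<Sum>m\<in>UNIV. \<Sum>j\<in>UNIV. Curv i l p $ i $ j * (h p $ j $ m * du p $ m))"
      unfolding Rh by (simp add: sum_negf sum_distrib_left sum_distrib_right h_sym_nth[OF p, of m for m] mult.assoc mult.commute mult.left_commute)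
    also have "\<dots> = (\<Sum>i\<in>UNIV. \<Sum>j\<in>UNIV. Curv i l p $ i $ j * (h p *v du p) $ j)"
      by (rule sum.cong[OF refl], subst sum.swap) (simp add: matrix_vector_mult_def sum_distrib_left)
    also have "\<dots> = (\<Sum>j\<in>UNIV. \<Sum>i\<in>UNIV. Curv i l p $ i $ j * (h p *v du p) $ j)"
      by (rule sum.swap)
    also have "\<dots> = ((h p *v du p) v* ricci G c p) $ l"
      by (simp add: vector_matrix_mult_def ric sum_distrib_left mult.commute)
    finally show ?thesis by simp
  qed
  then show ?thesis
    by (simp add: vec_eq_iff sum_component)
qed

end

section \<open>The Bismut Laplacian of a gradient\<close>

text \<open>Contracting S with h on both sides gives a kernel symmetric in i and r, and its pairing
  with the skew B vanishes.\<close>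

lemma sum_skew_sym_eq_0:
  fixes h :: "'n::finite \<Rightarrow> 'n \<Rightarrow> real"
  assumes "\<And>i j. h i j = h j i" "\<And>i j. B i j = - B j i" "\<And>i j. S i j = S j i"
  shows "(\<Sum>i\<in>UNIV. \<Sum>j\<in>UNIV. h i j * (\<Sum>r\<in>UNIV. \<Sum>s\<in>UNIV. h r s * B i r * S j s)) = 0"
    (is "?T = 0")
proof -
  have "?T = (\<Sum>i\<in>UNIV. \<Sum>r\<in>UNIV. (\<Sum>j\<in>UNIV. \<Sum>s\<in>UNIV. h i j * h r s * S j s) * B i r)"
    unfolding sum_distrib_left sum_distrib_right
    by (rule sum.cong[OF refl], subst sum.swap) (simp add: ac_simps)
  also have "\<dots> = (\<Sum>r\<in>UNIV. \<Sum>i\<in>UNIV. (\<Sum>j\<in>UNIV. \<Sum>s\<in>UNIV. h i j * h r s * S j s) * B i r)"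
    by (rule sum.swap)
  also have "\<dots> = (\<Sum>r\<in>UNIV. \<Sum>i\<in>UNIV. - ((\<Sum>j\<in>UNIV. \<Sum>s\<in>UNIV. h r j * h i s * S j s) * B r i))"
  proof (intro sum.cong refl)
    fix r i
    have "(\<Sum>j\<in>UNIV. \<Sum>s\<in>UNIV. h i j * h r s * S j s) = (\<Sum>j\<in>UNIV. \<Sum>s\<in>UNIV. h r j * h i s * S j s)"
      by (subst sum.swap) (simp add: assms(3) mult.commute)
    then show "(\<Sum>j\<in>UNIV. \<Sum>s\<in>UNIV. h i j * h r s * S j s) * B i r =
        - ((\<Sum>j\<in>UNIV. \<Sum>s\<in>UNIV. h r j * h i s * S j s) * B r i)"
      using assms(2)[of i r] by simp
  qed
  also have "\<dots> = - ?T"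
    unfolding sum_negf sum_distrib_left sum_distrib_right
    by (rule arg_cong[where f=uminus], rule sum.cong[OF refl], subst sum.swap) (simp add: ac_simps)
  finally show ?thesis by simp
qed

locale bismut_chart = riemannian_chart_function c g G u
  for c :: "('m, 'n::finite) chart" and g G u +
  fixes H :: "('m, 'n) tensor3"
  assumes diff_H: "diff_in c (H c)"
    and H_skew12: "p \<in> chart_dom c \<Longrightarrow> H c p $ i $ j $ k = - H c p $ j $ i $ k"
    and H_skew23: "p \<in> chart_dom c \<Longrightarrow> H c p $ i $ j $ k = - H c p $ i $ k $ j"
begin

text \<open>The last index of H is the row index, so that Hm i *v Z is the covector H(e_i, Z, -). Thus
  D_Hm i j p $ l $ m below is the component (D_i H)_{jml}.\<close>

definition Hm :: "'n \<Rightarrow> 'm \<Rightarrow> real^'n^'n" where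
  "Hm i q = (\<chi> l r. H c q $ i $ r $ l)"

definition D_Hm :: "'n \<Rightarrow> 'n \<Rightarrow> 'm \<Rightarrow> real^'n^'n" where
  "D_Hm i j p = pd c i (Hm j) p - transpose (Gam i p) ** Hm j p - Hm j p ** Gam i p
     - (\<Sum>m\<in>UNIV. Gam i p $ m $ j *\<^sub>R Hm m p)"

abbreviation Y :: "'m \<Rightarrow> real^'n" where
  "Y q \<equiv> h q *v du q"

definition W :: "'n \<Rightarrow> 'm \<Rightarrow> real^'n" where
  "W j q = hess j q + (1/2) *\<^sub>R (Hm j q *v Y q)"

abbreviation nab where "nab \<equiv> bismut g H G c"

section \<open>The Bismut connection in coordinates, applied to Y\<close>

lemma diff_Hm: "diff_in c (Hm i)"
proof -
  have "bounded_linear (\<lambda>T::real^'n^'n^'n. \<chi> l r. T $ i $ r $ l)"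
    unfolding linear_conv_bounded_linear[symmetric] by (auto intro!: linearI simp: vec_eq_iff)
  from diff_in_bounded_linear[OF this diff_H] show ?thesis
    by (simp add: Hm_def[abs_def])
qed

lemma diff_Y: "diff_in c Y"
  by (intro diff_in_bilinear[OF bounded_bilinear_matrix_vector_mult] diff_h diff_du)

lemma pd_Y:
  "p \<in> chart_dom c \<Longrightarrow> pd c i Y p = h p *v hess i p - Gam i p *v Y p"
  using cov_sharp[OF diff_du, of p i] by (simp add: hess_def algebra_simps)

lemma diff_HmY: "diff_in c (\<lambda>q. Hm j q *v Y q)"
  by (intro diff_in_bilinear[OF bounded_bilinear_matrix_vector_mult] diff_Hm diff_Y)

lemma diff_W: "diff_in c (W j)"
  unfolding W_def[abs_def]
  by (intro diff_in_add diff_hess diff_in_bounded_linear[OF bounded_linear_scaleR_right] diff_HmY)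

lemma bismut_coord_field:
  "nab (coord_field i) Z p = pd c i Z p + Gam i p *v Z p + (1/2) *\<^sub>R (h p *v (Hm i p *v Z p))"
proof -
  have "(\<Sum>a\<in>UNIV. \<Sum>j\<in>UNIV. H c p $ a $ j $ k * axis i 1 $ a * Z p $ j) =
      (\<Sum>a\<in>UNIV. if a = i then \<Sum>j\<in>UNIV. H c p $ i $ j $ k * Z p $ j else 0)" for k
    by (rule sum.cong) (auto simp: axis_def)
  then have "(\<chi> k. \<Sum>a\<in>UNIV. \<Sum>j\<in>UNIV. H c p $ a $ j $ k * coord_field i p $ a * Z p $ j) = Hm i p *v Z p"
    by (simp add: vec_eq_iff matrix_vector_mult_def Hm_def coord_field_def)
  then show ?thesis
    by (simp add: bismut_def cov_deriv_coord_field sharp_def)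
qed

text \<open>Tensoriality in the direction X. It serves the term of the Laplacian that differentiates
  along \<open>nab (coord_field i) (coord_field j)\<close>, in general not a coordinate
  field.\<close>

lemma bismut_linear: "nab X Z p = (\<Sum>m\<in>UNIV. X p $ m *\<^sub>R nab (coord_field m) Z p)"
proof -
  have 1: "cov_deriv G c X Z p = (\<Sum>m\<in>UNIV. X p $ m *\<^sub>R (pd c m Z p + Gam m p *v Z p))"
    by (simp add: cov_deriv_def dir_deriv_def vec_eq_iff sum_component scaleR_add_right sum.distrib
        matrix_vector_mult_def Gam_def sum_distrib_left ac_simps)
  have "(\<chi> k. \<Sum>i\<in>UNIV. \<Sum>j\<in>UNIV. H c p $ i $ j $ k * X p $ i * Z p $ j) =
      (\<Sum>m\<in>UNIV. X p $ m *\<^sub>R (Hm m p *v Z p))"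
    by (simp add: vec_eq_iff sum_component matrix_vector_mult_def Hm_def sum_distrib_left ac_simps)
  then have 2: "sharp (g c p) (\<chi> k. \<Sum>i\<in>UNIV. \<Sum>j\<in>UNIV. H c p $ i $ j $ k * X p $ i * Z p $ j) =
      (\<Sum>m\<in>UNIV. X p $ m *\<^sub>R (h p *v (Hm m p *v Z p)))"
    by (simp add: sharp_def bounded_bilinear.sum_right[OF bounded_bilinear_matrix_vector_mult] matrix_vector_simps)
  show ?thesis
    unfolding bismut_coord_field
    unfolding bismut_def 1 2
    by (simp add: scaleR_add_right sum.distrib scaleR_sum_right ac_simps)
qed

lemma bismut_sharp:
  assumes "diff_in c w" "p \<in> chart_dom c"
  shows "nab (coord_field i) (\<lambda>q. h q *v w q) p =
    h p *v (pd c i w p - w p v* Gam i p + (1/2) *\<^sub>R (Hm i p *v (h p *v w p)))"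
  unfolding bismut_coord_field cov_sharp[OF assms] by (simp add: matrix_vector_simps)

lemma bismut_Y: "p \<in> chart_dom c \<Longrightarrow> nab (coord_field i) Y p = h p *v W i p"
  unfolding bismut_sharp[OF diff_du] by (simp add: W_def hess_def)

lemma bismut_bismut_Y:
  assumes p: "p \<in> chart_dom c"
  shows "nab (coord_field i) (nab (coord_field j) Y) p =
    h p *v (pd c i (W j) p - W j p v* Gam i p + (1/2) *\<^sub>R (Hm i p *v (h p *v W j p)))"
proof -
  \<comment> \<open>\<open>bismut_Y\<close> holds only on the chart domain, so the two fields cannot
    be identified as functions; value and partial derivative at p are replaced separately.\<close>
  have pd: "pd c i (nab (coord_field j) Y) p = pd c i (\<lambda>q. h q *v W j q) p"
    by (rule pd_cong[OF bismut_Y p])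
  have "nab (coord_field i) (nab (coord_field j) Y) p = nab (coord_field i) (\<lambda>q. h q *v W j q) p"
    unfolding bismut_coord_field[of i "nab (coord_field j) Y"] bismut_coord_field[of i "\<lambda>q. h q *v W j q"]
      bismut_Y[OF p] pd ..
  then show ?thesis
    unfolding bismut_sharp[OF diff_W p] .
qed

lemma Hm_skew:
  assumes "p \<in> chart_dom c"
  shows "Hm i p $ l $ r = - Hm r p $ l $ i"
  unfolding Hm_def vec_lambda_beta by (rule H_skew12[OF assms])

lemma pd_W:
  assumes p: "p \<in> chart_dom c"
  shows "pd c i (W j) p = pd c i (hess j) p
    + (1/2) *\<^sub>R (pd c i (Hm j) p *v Y p + Hm j p *v (h p *v hess i p - Gam i p *v Y p))"
proof -
  have "pd c i (W j) p = pd c i (hess j) p + (1/2) *\<^sub>R pd c i (\<lambda>q. Hm j q *v Y q) p"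
    unfolding W_def[abs_def]
    by (subst pd_add) (auto simp: pd_bounded_linear[OF bounded_linear_scaleR_right diff_HmY p] diff_hess p
        intro!: diff_in_bounded_linear[OF bounded_linear_scaleR_right] diff_HmY)
  then show ?thesis
    unfolding pd_matrix_vector_mult[OF diff_Hm diff_Y p] pd_Y[OF p] .
qed

text \<open>The Leibniz rule for D, with j treated as a tensor index. Since D h = 0, the
  D-derivative of Y along e_i is h times \<open>hess i p\<close>, so the H term splits into a
  derivative of H and one pairing of H with the Hessian.\<close>

lemma D_W:
  assumes p: "p \<in> chart_dom c"
  shows "pd c i (W j) p - W j p v* Gam i p - (\<Sum>m\<in>UNIV. Gam i p $ m $ j *\<^sub>R W m p) =
    D_hess i j p + (1/2) *\<^sub>R (D_Hm i j p *v Y p) + (1/2) *\<^sub>R (Hm j p *v (h p *v hess i p))"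
proof -
  have D_Hm_Y: "D_Hm i j p *v Y p = pd c i (Hm j) p *v Y p - (Hm j p *v Y p) v* Gam i p
      - Hm j p *v (Gam i p *v Y p) - (\<Sum>m\<in>UNIV. Gam i p $ m $ j *\<^sub>R (Hm m p *v Y p))"
    by (simp add: D_Hm_def matrix_vector_simps bounded_bilinear.sum_left[OF bounded_bilinear_matrix_vector_mult]
        flip: matrix_vector_mul_assoc)
  show ?thesis
    unfolding pd_W[OF p] D_Hm_Y
    by (simp add: W_def D_hess_def matrix_vector_simps vector_matrix_simps
        sum.distrib scaleR_sum_right algebra_simps)
qed

section \<open>Metric traces of the terms of the Bismut Laplacian\<close>

lemma trace_skew:
  fixes v :: "'n \<Rightarrow> 'n \<Rightarrow> 'v::real_vector"
  assumes p: "p \<in> chart_dom c" and v: "\<And>i j. v i j = - v j i"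
  shows "(\<Sum>i\<in>UNIV. \<Sum>j\<in>UNIV. h p $ i $ j *\<^sub>R v i j) = 0"
proof -
  have "h p $ i $ j *\<^sub>R v i j = - (h p $ j $ i *\<^sub>R v j i)" for i j
    using v[of i j] h_sym_nth[OF p, of i j] by simp
  then have "(\<Sum>i\<in>UNIV. \<Sum>j\<in>UNIV. h p $ i $ j *\<^sub>R v i j) = - (\<Sum>i\<in>UNIV. \<Sum>j\<in>UNIV. h p $ j $ i *\<^sub>R v j i)"
    unfolding sum_negf[symmetric] by (intro sum.cong refl)
  also have "(\<Sum>i\<in>UNIV. \<Sum>j\<in>UNIV. h p $ j $ i *\<^sub>R v j i) = (\<Sum>i\<in>UNIV. \<Sum>j\<in>UNIV. h p $ i $ j *\<^sub>R v i j)"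
    by (rule sum.swap)
  finally show ?thesis
    by (simp add: eq_neg_iff_add_eq_0 flip: scaleR_2)
qed

lemma laplacian_Y:
  assumes p: "p \<in> chart_dom c"
  shows "laplacian_vec g c nab Y p = h p *v (\<Sum>i\<in>UNIV. \<Sum>j\<in>UNIV. h p $ i $ j *\<^sub>R
    (pd c i (W j) p - W j p v* Gam i p - (\<Sum>m\<in>UNIV. Gam i p $ m $ j *\<^sub>R W m p)
      + (1/2) *\<^sub>R (Hm i p *v (h p *v W j p))))"
proof -
  \<comment> \<open>Up to h, \<open>T i j\<close> is the Bismut derivative of Y along (1/2) H(e_i,
    e_j, -)^sharp, the H part of \<open>nab (coord_field i) (coord_field j)\<close>. Being skew in i
    and j, it is trace free.\<close>
  define T where "T i j = (\<Sum>m\<in>UNIV. ((1/2) *\<^sub>R (h p *v (Hm i p *v axis j 1))) $ m *\<^sub>R W m p)" for i j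
  have T_skew: "T i j = - T j i" for i j
  proof -
    have "Hm i p *v axis j 1 = - (Hm j p *v axis i 1)"
      using Hm_skew[OF p, of i _ j] by (simp add: vec_eq_iff matrix_vector_mult_axis)
    then show ?thesis
      unfolding T_def by (simp add: matrix_vector_simps sum_negf)
  qed
  have "nab (coord_field i) (coord_field j) p = Gam i p *v axis j 1 + (1/2) *\<^sub>R (h p *v (Hm i p *v axis j 1))" for i j
    unfolding bismut_coord_field by (simp add: coord_field_def pd_const)
  then have "nab (nab (coord_field i) (coord_field j)) Y p =
      h p *v ((\<Sum>m\<in>UNIV. Gam i p $ m $ j *\<^sub>R W m p) + T i j)" for i j
    unfolding bismut_linear[of "nab (coord_field i) (coord_field j)"] bismut_Y[OF p] T_def
    by (simp add: matrix_vector_simps bounded_bilinear.sum_right[OF bounded_bilinear_matrix_vector_mult]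
        matrix_vector_mult_axis scaleR_add_left sum.distrib)
  then have "laplacian_vec g c nab Y p = (\<Sum>i\<in>UNIV. \<Sum>j\<in>UNIV. h p $ i $ j *\<^sub>R (h p *v
    (pd c i (W j) p - W j p v* Gam i p - (\<Sum>m\<in>UNIV. Gam i p $ m $ j *\<^sub>R W m p)
      + (1/2) *\<^sub>R (Hm i p *v (h p *v W j p)) - T i j)))"
    unfolding laplacian_vec_def metric_trace_def bismut_bismut_Y[OF p]
    by (simp only: matrix_vector_simps add_diff_eq diff_diff_eq diff_add_eq ac_simps)
  also have "\<dots> = h p *v (\<Sum>i\<in>UNIV. \<Sum>j\<in>UNIV. h p $ i $ j *\<^sub>R
    (pd c i (W j) p - W j p v* Gam i p - (\<Sum>m\<in>UNIV. Gam i p $ m $ j *\<^sub>R W m p)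
      + (1/2) *\<^sub>R (Hm i p *v (h p *v W j p)))) - h p *v (\<Sum>i\<in>UNIV. \<Sum>j\<in>UNIV. h p $ i $ j *\<^sub>R T i j)"
    by (simp only: matrix_vector_simps(3,4,7,8) scaleR_diff_right sum_subtractf
        bounded_bilinear.sum_right[OF bounded_bilinear_matrix_vector_mult])
  finally show ?thesis
    using trace_skew[OF p T_skew] by simp
qed

text \<open>For a fixed output index l the entry \<open>Hm i p $ l $ r\<close> is skew in i and r,
  while the Hessian is symmetric.\<close>

lemma trace_Hm_hess:
  assumes p: "p \<in> chart_dom c"
  shows "(\<Sum>i\<in>UNIV. \<Sum>j\<in>UNIV. h p $ i $ j *\<^sub>R (Hm i p *v (h p *v hess j p))) = 0"
proof -
  have "(\<Sum>i\<in>UNIV. \<Sum>j\<in>UNIV. h p $ i $ j *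
      (\<Sum>r\<in>UNIV. \<Sum>s\<in>UNIV. h p $ r $ s * Hm i p $ l $ r * hess j p $ s)) = 0" for l
    by (rule sum_skew_sym_eq_0) (rule h_sym_nth[OF p] Hm_skew[OF p] hess_sym[OF p])+
  then show ?thesis
    by (simp add: vec_eq_iff sum_component matrix_vector_mult_def sum_distrib_left ac_simps)
qed

lemma trace_Hm_hess':
  assumes p: "p \<in> chart_dom c"
  shows "(\<Sum>i\<in>UNIV. \<Sum>j\<in>UNIV. h p $ i $ j *\<^sub>R (Hm j p *v (h p *v hess i p))) = 0"
  by (subst sum.swap) (simp add: trace_Hm_hess[OF p] h_sym_nth[OF p, of _ i for i])

text \<open>The trace contracts the direction of D with the first slot of H, as the codifferential
  does up to its sign; the vector Z then occupies the first remaining slot.\<close>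

lemma trace_D_Hm:
  assumes p: "p \<in> chart_dom c"
  shows "(\<Sum>i\<in>UNIV. \<Sum>j\<in>UNIV. h p $ i $ j *\<^sub>R (D_Hm i j p *v Z)) = - (Z v* codiff3 g G H c p)"
proof -
  have D: "D_Hm i j p $ l $ m = cov_deriv3 G H c i j m l p" for i j l m
    by (simp add: D_Hm_def cov_deriv3_def pd_nth_nth[OF diff_Hm p] matrix_matrix_mult_def transpose_def
        sum_component sum.distrib, simp add: Hm_def Gam_def algebra_simps)
  have "(\<Sum>i\<in>UNIV. \<Sum>j\<in>UNIV. h p $ i $ j * (\<Sum>m\<in>UNIV. cov_deriv3 G H c i j m l p * Z $ m)) =
      (\<Sum>m\<in>UNIV. Z $ m * (\<Sum>i\<in>UNIV. \<Sum>j\<in>UNIV. h p $ i $ j * cov_deriv3 G H c i j m l p))" for l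
  proof -
    have "(\<Sum>i\<in>UNIV. \<Sum>j\<in>UNIV. h p $ i $ j * (\<Sum>m\<in>UNIV. cov_deriv3 G H c i j m l p * Z $ m)) =
      (\<Sum>i\<in>UNIV. \<Sum>m\<in>UNIV. \<Sum>j\<in>UNIV. Z $ m * (h p $ i $ j * cov_deriv3 G H c i j m l p))"
      unfolding sum_distrib_left by (rule sum.cong[OF refl], subst sum.swap) (simp add: ac_simps)
    also have "\<dots> = (\<Sum>m\<in>UNIV. \<Sum>i\<in>UNIV. \<Sum>j\<in>UNIV. Z $ m * (h p $ i $ j * cov_deriv3 G H c i j m l p))"
      by (rule sum.swap)
    finally show ?thesis by (simp only: sum_distrib_left)
  qed
  then show ?thesis
    by (simp add: vec_eq_iff sum_component matrix_vector_mult_def vector_matrix_mult_def D codiff3_def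
        metric_trace_def sum_negf)
qed

lemma trace_Hm_Hm:
  assumes p: "p \<in> chart_dom c"
  shows "(\<Sum>i\<in>UNIV. \<Sum>j\<in>UNIV. h p $ i $ j *\<^sub>R (Hm i p *v (h p *v (Hm j p *v Z)))) =
    - (Z v* H_squared g H c p)"
proof -
  \<comment> \<open>A cyclic rotation of the first H and one transposition of the second bring the
    free indices l and m to the front; the transposition is the source of the minus sign.\<close>
  have skew: "Hm i p $ l $ r * Hm j p $ s $ m = - (H c p $ l $ i $ r * H c p $ m $ j $ s)" for i r l j s m
  proof -
    have "H c p $ i $ r $ l = H c p $ l $ i $ r"
      using H_skew12[OF p, of l i r] H_skew23[OF p, of i l r] by simp
    then show ?thesis
      using H_skew12[OF p, of j m s] by (simp add: Hm_def)
  qed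
  have "(\<Sum>i\<in>UNIV. \<Sum>j\<in>UNIV. h p $ i $ j *
        (\<Sum>r\<in>UNIV. Hm i p $ l $ r * (\<Sum>s\<in>UNIV. h p $ r $ s * (\<Sum>m\<in>UNIV. Hm j p $ s $ m * Z $ m)))) =
      - (\<Sum>m\<in>UNIV. Z $ m * (\<Sum>k\<in>UNIV. \<Sum>a\<in>UNIV. \<Sum>r\<in>UNIV. \<Sum>s\<in>UNIV.
        h p $ k $ a * h p $ r $ s * H c p $ m $ k $ r * H c p $ l $ a $ s))" (is "?L = - ?R") for l
  proof -
    let ?f = "\<lambda>i j r s m. h p $ i $ j * h p $ r $ s * (H c p $ l $ i $ r * H c p $ m $ j $ s) * Z $ m"
    have "?L = (\<Sum>i\<in>UNIV. \<Sum>j\<in>UNIV. \<Sum>r\<in>UNIV. \<Sum>s\<in>UNIV. \<Sum>m\<in>UNIV.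
        h p $ i $ j * h p $ r $ s * (Hm i p $ l $ r * Hm j p $ s $ m) * Z $ m)"
      by (simp add: sum_distrib_left ac_simps)
    also have "\<dots> = - (\<Sum>i\<in>UNIV. \<Sum>j\<in>UNIV. \<Sum>r\<in>UNIV. \<Sum>s\<in>UNIV. \<Sum>m\<in>UNIV. ?f i j r s m)"
      unfolding skew by (simp add: sum_negf)
    also have "(\<Sum>i\<in>UNIV. \<Sum>j\<in>UNIV. \<Sum>r\<in>UNIV. \<Sum>s\<in>UNIV. \<Sum>m\<in>UNIV. ?f i j r s m) =
        (\<Sum>(i, j, r, s, m)\<in>UNIV. ?f i j r s m)"
      by (simp add: sum.cartesian_product UNIV_Times_UNIV)
    \<comment> \<open>The renaming gives the factor with m the index pair (k, r) and the factor with
      l the pair (a, s), as in \<open>H_squared\<close>; symmetry of h absorbs the exchanged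
      arguments.\<close>
    also have "\<dots> = (\<Sum>(m, k, a, r, s)\<in>UNIV. ?f a k s r m)"
      by (rule sum.reindex_bij_witness[of _ "\<lambda>(m, k, a, r, s). (a, k, s, r, m)" "\<lambda>(i, j, r, s, m). (m, j, i, s, r)"])
        auto
    also have "\<dots> = (\<Sum>m\<in>UNIV. \<Sum>k\<in>UNIV. \<Sum>a\<in>UNIV. \<Sum>r\<in>UNIV. \<Sum>s\<in>UNIV. ?f a k s r m)"
      by (simp add: sum.cartesian_product UNIV_Times_UNIV)
    also have "\<dots> = ?R"
      unfolding sum_distrib_left
      by (intro sum.cong refl) (simp add: h_sym_nth[OF p, of x k for x k] ac_simps)
    finally show ?thesis .
  qed
  then show ?thesis
    by (simp add: vec_eq_iff sum_component matrix_vector_mult_def vector_matrix_mult_def H_squared_def)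
qed

lemma laplacian_grad:
  assumes p: "p \<in> chart_dom c"
  shows "laplacian_vec g c nab (grad g u c) p =
    sharp (g c p) (\<chi> l. pd c l lap p) + sharp (g c p) (grad g u c p v* bismut_ricci g H G c p)"
proof -
  have "laplacian_vec g c nab Y p = h p *v (\<Sum>i\<in>UNIV. \<Sum>j\<in>UNIV. h p $ i $ j *\<^sub>R
      (D_hess i j p + (1/2) *\<^sub>R (D_Hm i j p *v Y p) + (1/2) *\<^sub>R (Hm j p *v (h p *v hess i p))
        + (1/2) *\<^sub>R (Hm i p *v (h p *v hess j p)) + (1/4) *\<^sub>R (Hm i p *v (h p *v (Hm j p *v Y p)))))"
    unfolding laplacian_Y[OF p] D_W[OF p]
    by (simp add: W_def matrix_vector_simps scaleR_add_right add.assoc)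
  also have "(\<Sum>i\<in>UNIV. \<Sum>j\<in>UNIV. h p $ i $ j *\<^sub>R
      (D_hess i j p + (1/2) *\<^sub>R (D_Hm i j p *v Y p) + (1/2) *\<^sub>R (Hm j p *v (h p *v hess i p))
        + (1/2) *\<^sub>R (Hm i p *v (h p *v hess j p)) + (1/4) *\<^sub>R (Hm i p *v (h p *v (Hm j p *v Y p))))) =
      (\<Sum>i\<in>UNIV. \<Sum>j\<in>UNIV. h p $ i $ j *\<^sub>R D_hess i j p)
      + (1/2) *\<^sub>R (\<Sum>i\<in>UNIV. \<Sum>j\<in>UNIV. h p $ i $ j *\<^sub>R (D_Hm i j p *v Y p))
      + (1/2) *\<^sub>R (\<Sum>i\<in>UNIV. \<Sum>j\<in>UNIV. h p $ i $ j *\<^sub>R (Hm j p *v (h p *v hess i p)))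
      + (1/2) *\<^sub>R (\<Sum>i\<in>UNIV. \<Sum>j\<in>UNIV. h p $ i $ j *\<^sub>R (Hm i p *v (h p *v hess j p)))
      + (1/4) *\<^sub>R (\<Sum>i\<in>UNIV. \<Sum>j\<in>UNIV. h p $ i $ j *\<^sub>R (Hm i p *v (h p *v (Hm j p *v Y p))))"
    by (simp only: scaleR_add_right sum.distrib scaleR_sum_right scaleR_scaleR mult.commute)
  \<comment> \<open>Both Hessian traces vanish. Ricci from the Bochner formula, 1/2 times minus d^*H
    and 1/4 times minus H^2 make up \<open>bismut_ricci\<close>.\<close>
  also have "\<dots> = (\<chi> l. pd c l lap p) + Y p v* bismut_ricci g H G c p"
    unfolding bochner[OF p] trace_D_Hm[OF p] trace_Hm_hess[OF p] trace_Hm_hess'[OF p] trace_Hm_Hm[OF p]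
    by (simp add: bismut_ricci_def vector_matrix_simps)
  finally show ?thesis
    by (simp add: grad_eq sharp_def matrix_vector_simps)
qed

end

section \<open>Time derivatives\<close>

lemma has_derivative_slice_fst:
  assumes "F differentiable (at (x, t))"
  shows "((\<lambda>x. F (x, t)) has_derivative (\<lambda>v. frechet_derivative F (at (x, t)) (v, 0))) (at x)"
proof -
  have "((\<lambda>x. (x, t)) has_derivative (\<lambda>v. (v, 0))) (at x)"
    by (auto intro!: derivative_eq_intros)
  from has_derivative_compose[OF this] show ?thesis
    using assms unfolding frechet_derivative_works by blast
qed

lemma has_vector_derivative_slice_snd:
  assumes "F differentiable (at (x, t :: real))"
  shows "((\<lambda>t. F (x, t)) has_vector_derivative frechet_derivative F (at (x, t)) (0, 1)) (at t)"
proof -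
  let ?D = "frechet_derivative F (at (x, t))"
  have "((\<lambda>t. (x, t)) has_derivative (\<lambda>s. (0, s))) (at t)"
    by (auto intro!: derivative_eq_intros)
  from has_derivative_compose[OF this] have "((\<lambda>t. F (x, t)) has_derivative (\<lambda>s. ?D (0, s))) (at t)"
    using assms unfolding frechet_derivative_works by blast
  moreover have "(\<lambda>s. ?D (0, s)) = (\<lambda>s. s *\<^sub>R ?D (0, 1))"
  proof
    show "?D (0, s) = s *\<^sub>R ?D (0, 1)" for s
      using linear_cmul[OF linear_frechet_derivative[OF assms], of s "(0, 1)"] by simp
  qed
  ultimately show ?thesis
    unfolding has_vector_derivative_def by (simp only:)
qed

lemma open_slice_fst: "open W \<Longrightarrow> open {x. (x, t) \<in> W}"
  using open_vimage[of W "\<lambda>x. (x, t)"] by (simp add: vimage_def continuous_on_Pair)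

lemma open_slice_snd: "open W \<Longrightarrow> open {t. (x, t) \<in> W}"
  using open_vimage[of W "\<lambda>t. (x, t)"] by (simp add: vimage_def continuous_on_Pair)

text \<open>The derivative of a slice along v is the slice of the derivative of F along (v, 0), so
  the induction runs over F.\<close>

lemma Ck_on_slice:
  assumes "open W" "Ck_on k W F"
  shows "Ck_on k {x. (x, t) \<in> W} (\<lambda>x. F (x, t))"
  using assms(2)
proof (induction k arbitrary: F)
  case 0
  then show ?case
    by (auto intro!: continuous_on_compose2[of W F] continuous_intros)
next
  case (Suc k)
  have d: "((\<lambda>x. F (x, t)) has_derivative (\<lambda>v. frechet_derivative F (at (x, t)) (v, 0))) (at x)"
    if "(x, t) \<in> W" for x
    using Suc.prems that by (intro has_derivative_slice_fst) simp
  have "Ck_on k {x. (x, t) \<in> W} (\<lambda>x. frechet_derivative (\<lambda>x. F (x, t)) (at x) v)" for v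
  proof -
    have "Ck_on k {x. (x, t) \<in> W} (\<lambda>x. frechet_derivative F (at (x, t)) (v, 0))"
      by (rule Suc.IH) (use Suc.prems in simp)
    then show ?thesis
      by (subst Ck_on_cong[OF open_slice_fst[OF assms(1)]])
        (auto simp: frechet_derivative_at[OF d, symmetric])
  qed
  then show ?case
    using d by (auto simp: differentiable_def)
qed

lemma smooth_on_slice:
  assumes "smooth_on (U \<times> I) (\<lambda>(x, t). f t x)" "t \<in> I"
  shows "smooth_on U (f t)"
  unfolding smooth_on_def
proof
  fix x assume "x \<in> U"
  then obtain W F where W: "open W" "(x, t) \<in> W" "\<forall>k. Ck_on k W F"
      "\<forall>y\<in>W \<inter> U \<times> I. F y = (case y of (x, t) \<Rightarrow> f t x)"
    using assms unfolding smooth_on_def by (metis SigmaI)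
  show "\<exists>W F. open W \<and> x \<in> W \<and> (\<forall>k. Ck_on k W F) \<and> (\<forall>y\<in>W \<inter> U. F y = f t y)"
  proof (intro exI conjI)
    show "open {x. (x, t) \<in> W}" by (rule open_slice_fst[OF W(1)])
    show "\<forall>k. Ck_on k {x. (x, t) \<in> W} (\<lambda>x. F (x, t))"
      using Ck_on_slice[OF W(1)] W(3) by blast
  qed (use W assms(2) in auto)
qed

text \<open>Passes from the two-sided derivative of a smooth extension to the possibly one-sided
  derivative of the given map, which agrees with the extension only on I near t.\<close>

lemma has_vector_derivative_within_transform_open:
  assumes "(f has_vector_derivative D) (at t)" "t \<in> I" "open V" "t \<in> V"
    "\<And>s. s \<in> V \<Longrightarrow> s \<in> I \<Longrightarrow> f s = f' s"
  shows "(f' has_vector_derivative D) (at t within I)"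
proof -
  obtain d where "d > 0" "ball t d \<subseteq> V"
    using assms openE by blast
  then show ?thesis
    using assms(5) has_vector_derivative_at_within[OF assms(1)]
    by (intro has_vector_derivative_transform_within[of f D t I d f'])
      (auto simp: assms(2) dist_commute subset_iff)
qed

lemma smooth_on_time_differentiable:
  fixes I :: "real set"
  assumes "smooth_on (U \<times> I) (\<lambda>(x, t). f t x)" "x \<in> U" "t \<in> I"
  shows "(\<lambda>s. f s x) differentiable (at t within I)"
proof -
  obtain W F where W: "open W" "(x, t) \<in> W" "\<forall>k. Ck_on k W F"
      "\<forall>y\<in>W \<inter> U \<times> I. F y = (case y of (x, t) \<Rightarrow> f t x)"
    using assms unfolding smooth_on_def by (metis SigmaI)
  have "Ck_on (Suc 0) W F" using W(3) by blast
  then have "F differentiable (at (x, t))" using W(2) by simp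
  from has_vector_derivative_within_transform_open[OF has_vector_derivative_slice_snd[OF this] assms(3)
      open_slice_snd[OF W(1)], of x "\<lambda>s. f s x"]
  have "((\<lambda>s. f s x) has_vector_derivative frechet_derivative F (at (x, t)) (0, 1)) (at t within I)"
    using W(2,4) assms(2) by auto
  then show ?thesis
    unfolding has_vector_derivative_def differentiable_def by blast
qed

section \<open>Existence and uniqueness of one-sided time derivatives\<close>

lemma dt_eqI:
  assumes "at t within I \<noteq> bot" "(f has_vector_derivative D) (at t within I)"
  shows "dt I t f = D"
  unfolding dt_def using vector_derivative_within assms by blast

lemma differentiable_has_dt:
  "f differentiable (at t within I) \<Longrightarrow> (f has_vector_derivative dt I t f) (at t within I)"
  unfolding dt_def by (simp add: vector_derivative_works)

text \<open>An interval with interior points is a connected set with more than one point, hence has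
  no isolated points. This makes derivatives within I unique.\<close>

lemma at_within_interval_neq_bot:
  fixes I :: "real set"
  assumes "is_interval I" "interior I \<noteq> {}" "t \<in> I"
  shows "at t within I \<noteq> bot"
proof -
  have "I \<noteq> {t}" using assms(2) by auto
  then show ?thesis
    using connected_imp_perfect[of I t] assms is_interval_connected[of I]
    by (auto simp: trivial_limit_within)
qed

text \<open>At an end point of I, where the time derivative is one-sided, the two derivatives are
  read off a smooth extension F of u to an open subset of spacetime.\<close>

lemma (in coordinate_chart) has_vector_derivative_pd:
  fixes u :: "real \<Rightarrow> 'm \<Rightarrow> 'b::euclidean_space"
  assumes u: "smooth_on (chart_img c \<times> I) (\<lambda>(x, t). u t (chart_inv c x))"
    and t: "t \<in> I" "at t within I \<noteq> bot" and p: "p \<in> chart_dom c"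
  shows "((\<lambda>s. pd c i (u s) p) has_vector_derivative pd c i (\<lambda>q. dt I t (\<lambda>s. u s q)) p) (at t within I)"
proof -
  let ?x = "chart_map c p"
  let ?e = "(axis i 1, 0) :: (real^'n) \<times> real"
  let ?t = "(0, 1) :: (real^'n) \<times> real"
  have x: "?x \<in> chart_img c" using p by blast
  obtain W F where W: "open W" "(?x, t) \<in> W" "\<forall>k. Ck_on k W F"
      "\<forall>y\<in>W \<inter> chart_img c \<times> I. F y = (case y of (x, t) \<Rightarrow> u t (chart_inv c x))"
    using u x t unfolding smooth_on_def by (metis SigmaI)
  have F_eq: "F (y, s) = u s (chart_inv c y)" if "(y, s) \<in> W" "y \<in> chart_img c" "s \<in> I" for y s
    using W(4) that by auto
  have C2: "Ck_on (Suc (Suc 0)) W F" using W(3) by blast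
  have F: "F differentiable (at y)" if "y \<in> W" for y
    using C2 that by simp
  have DF: "(\<lambda>y. frechet_derivative F (at y) v) differentiable (at y)" if "y \<in> W" for y v
    using C2 that by (cases v) simp
  have nbhd: "open ({y. (y, s) \<in> W} \<inter> chart_img c)" for s
    by (intro open_Int open_slice_fst W open_img)
  have pd_u: "pd c i (u s) p = frechet_derivative F (at (?x, s)) ?e" if s: "(?x, s) \<in> W" "s \<in> I" for s
  proof (rule pd_eqI[THEN trans])
    show "((u s \<circ> chart_inv c) has_derivative (\<lambda>v. frechet_derivative F (at (?x, s)) (v, 0))) (at ?x)"
      by (rule has_derivative_transform_within_open[OF has_derivative_slice_fst[OF F[OF s(1)]] nbhd[of s]])
        (use x s F_eq in auto)
  qed simp
  have "((\<lambda>s. frechet_derivative F (at (?x, s)) ?e) has_vector_derivative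
      frechet_derivative (\<lambda>y. frechet_derivative F (at y) ?e) (at (?x, t)) ?t) (at t)"
    by (rule has_vector_derivative_slice_snd[OF DF[OF W(2)]])
  then have 1: "((\<lambda>s. pd c i (u s) p) has_vector_derivative
      frechet_derivative (\<lambda>y. frechet_derivative F (at y) ?e) (at (?x, t)) ?t) (at t within I)"
    by (rule has_vector_derivative_within_transform_open[OF _ t(1) open_slice_snd[OF W(1), of ?x]])
      (use W(2) pd_u in auto)
  have dt_u: "dt I t (\<lambda>s. u s (chart_inv c y)) = frechet_derivative F (at (y, t)) ?t"
    if y: "(y, t) \<in> W" "y \<in> chart_img c" for y
    by (rule dt_eqI[OF t(2)],
        rule has_vector_derivative_within_transform_open[OF has_vector_derivative_slice_snd[OF F[OF y(1)]] t(1)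
          open_slice_snd[OF W(1), of y]])
      (use y F_eq in auto)
  have "pd c i (\<lambda>q. dt I t (\<lambda>s. u s q)) p =
      frechet_derivative (\<lambda>y. frechet_derivative F (at y) ?t) (at (?x, t)) ?e"
  proof (rule pd_eqI[THEN trans])
    show "((\<lambda>q. dt I t (\<lambda>s. u s q)) \<circ> chart_inv c has_derivative
        (\<lambda>v. frechet_derivative (\<lambda>y. frechet_derivative F (at y) ?t) (at (?x, t)) (v, 0))) (at ?x)"
      by (rule has_derivative_transform_within_open[OF has_derivative_slice_fst[OF DF[OF W(2)]] nbhd[of t]])
        (use x W(2) dt_u in auto)
  qed simp
  \<comment> \<open>Both derivatives are taken of F, on an open subset of spacetime, along the
    directions e_i and d_t; so mixed derivatives commute even when t is an end point of I.\<close>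
  also have "\<dots> = frechet_derivative (\<lambda>y. frechet_derivative F (at y) ?e) (at (?x, t)) ?t"
    using W by (intro frechet_derivative_commute[of W]) auto
  finally show ?thesis
    using 1 by simp
qed

section \<open>Time derivatives of vectors and matrices\<close>

lemma has_vector_derivative_vec_lambda:
  fixes f :: "'n::finite \<Rightarrow> real \<Rightarrow> 'b::euclidean_space"
  assumes "\<And>i. (f i has_vector_derivative f' i) (at t within S)"
  shows "((\<lambda>s. \<chi> i. f i s) has_vector_derivative (\<chi> i. f' i)) (at t within S)"
proof -
  have "((\<lambda>s. \<chi> i. f i s) has_derivative (\<lambda>s. \<chi> i. s *\<^sub>R f' i)) (at t within S)"
    using assms unfolding has_vector_derivative_def by (rule has_derivative_vec_lambda)
  moreover have "(\<lambda>s. \<chi> i. s *\<^sub>R f' i) = (\<lambda>s. s *\<^sub>R (\<chi> i. f' i))"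
    by (simp add: fun_eq_iff vec_eq_iff)
  ultimately show ?thesis
    by (simp add: has_vector_derivative_def)
qed

text \<open>Differentiability of the inverse comes from Cramer's rule; only then may the product of
  inverse and matrix be differentiated and the equation solved for the derivative.\<close>

lemma has_vector_derivative_matrix_inv:
  fixes M :: "real \<Rightarrow> real^'n^'n"
  assumes M: "(M has_vector_derivative M') (at t within I)" and t: "t \<in> I" "at t within I \<noteq> bot"
    and inv: "\<And>s. s \<in> I \<Longrightarrow> invertible (M s)"
  shows "((\<lambda>s. matrix_inv (M s)) has_vector_derivative - (matrix_inv (M t) ** M' ** matrix_inv (M t)))
    (at t within I)"
proof -
  let ?N = "\<lambda>s. matrix_inv (M s)"
  have "?N differentiable (at t within I)"
    using M t(1) inv by (intro differentiable_matrix_inv) (auto simp: has_vector_derivative_def differentiable_def)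
  then obtain N' where N': "(?N has_vector_derivative N') (at t within I)"
    using vector_derivative_works by blast
  have "((\<lambda>s. ?N s ** M s) has_vector_derivative ?N t ** M' + N' ** M t) (at t within I)"
    by (rule bounded_bilinear.has_vector_derivative[OF bounded_bilinear_matrix_mult N' M])
  moreover have "((\<lambda>s. ?N s ** M s) has_vector_derivative 0) (at t within I)"
    by (rule has_vector_derivative_transform[OF t(1) _ has_vector_derivative_const[of "mat 1"]])
      (simp add: matrix_inv_mult inv)
  ultimately have "?N t ** M' + N' ** M t = 0"
    using vector_derivative_unique_within[OF t(2)] by blast
  then have "N' ** M t = - (?N t ** M')"
    by (simp only: eq_neg_iff_add_eq_0 add.commute)
  then have "(N' ** M t) ** ?N t = - (?N t ** M') ** ?N t"
    by (rule arg_cong)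
  then have "N' = - (?N t ** M' ** ?N t)"
    using matrix_inv_mult(1)[OF inv[OF t(1)]] by (simp add: matrix_mult_simps flip: matrix_mul_assoc)
  then show ?thesis using N' by simp
qed

text \<open>Transposition is linear and the derivative within I is unique. Applied to the metric,
  this lets its time derivative act on a vector from either side.\<close>

lemma dt_symmetric:
  fixes M :: "real \<Rightarrow> real^'n^'n"
  assumes M: "(M has_vector_derivative M') (at t within I)" and t: "t \<in> I" "at t within I \<noteq> bot"
    and sym: "\<And>s. s \<in> I \<Longrightarrow> transpose (M s) = M s"
  shows "transpose M' = M'"
proof -
  have "((\<lambda>s. transpose (M s)) has_vector_derivative transpose M') (at t within I)"
    by (rule bounded_linear.has_vector_derivative[OF bounded_linear_transpose M])
  then have "(M has_vector_derivative transpose M') (at t within I)"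
    by (rule has_vector_derivative_transform[OF t(1), rotated]) (simp add: sym)
  from vector_derivative_unique_within[OF t(2) this M] show ?thesis .
qed

section \<open>The evolution equation\<close>

lemma smooth_manifold_coordinate_chart:
  assumes "smooth_manifold A" "c \<in> A"
  shows "coordinate_chart c"
proof
  have "homeomorphism (chart_dom c) (chart_img c) (chart_map c) (chart_inv c)" and "open (chart_img c)"
    using assms unfolding smooth_manifold_def by auto
  then show "open (chart_img c)" "\<And>p. p \<in> chart_dom c \<Longrightarrow> chart_inv c (chart_map c p) = p"
    unfolding homeomorphism_def by auto
qed

context coordinate_chart
begin

lemma diff_in_ext_d2:
  assumes "smooth_in c (b c)"
  shows "diff_in c (ext_d2 b c)"
proof -
  have "smooth_in c (\<lambda>q. b c q $ j $ k)" for j k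
    by (rule smooth_in_bounded_linear[OF bounded_linear_vec_nth_nth assms])
  then have "diff_in c (pd c i (\<lambda>q. b c q $ j $ k))" for i j k
    by (intro smooth_in_diff_in smooth_in_pd)
  then show ?thesis
    unfolding ext_d2_def[abs_def] by (intro diff_in_vec_lambda diff_in_add diff_in_diff)
qed

lemma ext_d2_skew:
  assumes b: "diff_in c (b c)" "\<And>q i j. q \<in> chart_dom c \<Longrightarrow> b c q $ i $ j = - b c q $ j $ i"
    and p: "p \<in> chart_dom c"
  shows "ext_d2 b c p $ i $ j $ k = - ext_d2 b c p $ j $ i $ k"
    and "ext_d2 b c p $ i $ j $ k = - ext_d2 b c p $ i $ k $ j"
proof -
  have "pd c l (\<lambda>q. b c q $ i $ j) p = - pd c l (\<lambda>q. b c q $ j $ i) p" for i j l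
  proof -
    have "pd c l (\<lambda>q. b c q $ i $ j) p = pd c l (\<lambda>q. - b c q $ j $ i) p"
      by (rule pd_cong[OF b(2) p])
    then show ?thesis
      using pd_bounded_linear[OF bounded_linear_minus[OF bounded_linear_ident]
          diff_in_bounded_linear[OF bounded_linear_vec_nth_nth b(1)] p, of l j i] by simp
  qed
  from this[of i i j] this[of j i k] this[of k i j] this[of i j k]
  show "ext_d2 b c p $ i $ j $ k = - ext_d2 b c p $ j $ i $ k"
    "ext_d2 b c p $ i $ j $ k = - ext_d2 b c p $ i $ k $ j"
    by (simp_all add: ext_d2_def)
qed

end

text \<open>Extracts from the global data at one time the local hypotheses of the chart computation;
  H obtains skewness and differentiability from its summands H0 and db.\<close>

lemma bismut_chartI:
  fixes A :: "('m::{t2_space,second_countable_topology}, 'n::finite) chart set"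
  assumes "smooth_manifold A" and c: "c \<in> A" and g: "riemannian_metric A g" and G: "levi_civita A g G"
    and b: "two_form A b" and H0: "three_form A H0" and H: "H = (\<lambda>c p. H0 c p + ext_d2 b c p)"
    and u: "smooth_on (chart_img c) (\<lambda>x. u (chart_inv c x))"
  shows "bismut_chart c g G u H"
proof -
  interpret coordinate_chart c
    by (rule smooth_manifold_coordinate_chart[OF assms(1,2)])
  have b_smooth: "smooth_in c (b c)" and b_skew: "\<And>q i j. q \<in> chart_dom c \<Longrightarrow> b c q $ i $ j = - b c q $ j $ i"
    using b c unfolding two_form_def tensor2_field_def smooth_components_def smooth_in_def o_def by blast+
  have H0_smooth: "smooth_in c (H0 c)"
    using H0 c unfolding three_form_def tensor3_field_def smooth_components_def smooth_in_def o_def by blast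
  have H0_skew: "H0 c q $ i $ j $ k = - H0 c q $ j $ i $ k" "H0 c q $ i $ j $ k = - H0 c q $ i $ k $ j"
    if "q \<in> chart_dom c" for q i j k
    using H0 c that unfolding three_form_def by blast+
  note d_skew = ext_d2_skew[of b, OF smooth_in_diff_in[OF b_smooth] b_skew]
  show ?thesis
  proof unfold_locales
    show "smooth_in c (g c)" "smooth_in c (G c)" "smooth_in c u"
      using g G u c unfolding riemannian_metric_def tensor2_field_def levi_civita_def affine_connection_def
        smooth_components_def smooth_in_def o_def by blast+
    show "diff_in c (H c)"
      unfolding H by (intro diff_in_add smooth_in_diff_in[OF H0_smooth] diff_in_ext_d2[of b, OF b_smooth])
    fix p assume p: "p \<in> chart_dom c"
    show "transpose (g c p) = g c p" "v \<noteq> 0 \<Longrightarrow> 0 < v \<bullet> (g c p *v v)" for v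
      using g c p unfolding riemannian_metric_def by blast+
    show "G c p $ k $ i $ j = G c p $ k $ j $ i" "pd c k (\<lambda>q. g c q $ i $ j) p =
      (\<Sum>l\<in>UNIV. G c p $ l $ k $ i * g c p $ l $ j + G c p $ l $ k $ j * g c p $ i $ l)" for i j k
      using G c p unfolding levi_civita_def by blast+
    show "H c p $ i $ j $ k = - H c p $ j $ i $ k" "H c p $ i $ j $ k = - H c p $ i $ k $ j" for i j k
      unfolding H using H0_skew[OF p, of i j k] d_skew(1)[OF _ p, of i j k] d_skew(2)[OF _ p, of i j k]
      by simp_all
  qed
qed

theorem proposition3p3:
  fixes A :: "('m::{t2_space,second_countable_topology}, 'n::finite) chart set"
    and I :: "real set"
    and g b :: "real \<Rightarrow> ('m, 'n) tensor2"
    and H0 :: "('m, 'n) tensor3"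
    and H :: "real \<Rightarrow> ('m, 'n) tensor3"
    and D :: "real \<Rightarrow> ('m, 'n) tensor3"
    and u :: "real \<Rightarrow> 'm \<Rightarrow> real"
  assumes "smooth_manifold A"
    and "is_interval I" and "interior I \<noteq> {}"
    and "\<And>t. t \<in> I \<Longrightarrow> riemannian_metric A (g t)" and "smooth_family A I g"
    and "\<And>t. t \<in> I \<Longrightarrow> two_form A (b t)" and "smooth_family A I b"
    and "closed_three_form A H0"
    and "\<And>t. t \<in> I \<Longrightarrow> H t = (\<lambda>c p. H0 c p + ext_d2 (b t) c p)"
    and "\<And>t. t \<in> I \<Longrightarrow> levi_civita A (g t) (D t)"
    and "smooth_family A I (\<lambda>t c. u t)"
    and "\<And>t c p. t \<in> I \<Longrightarrow> c \<in> A \<Longrightarrow> p \<in> chart_dom c \<Longrightarrow>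
           dt I t (\<lambda>s. u s p) = laplacian_fun (g t) c (cov_deriv (D t) c) (u t) p"
  shows "\<forall>t\<in>I. \<forall>c\<in>A. \<forall>p\<in>chart_dom c.
           nabla_t I g b c (\<lambda>s. grad (g s) (u s) c) t p =
             laplacian_vec (g t) c (bismut (g t) (H t) (D t) c) (grad (g t) (u t) c) p
             - sharp (g t c p)
                 (grad (g t) (u t) c p v*
                   (bismut_ricci (g t) (H t) (D t) c p
                    + (1/2) *\<^sub>R dt I t (\<lambda>s. g s c p - b s c p)))"
proof (intro ballI)
  fix t c p
  assume t: "t \<in> I" and c: "c \<in> A" and p: "p \<in> chart_dom c"
  have bot: "at t within I \<noteq> bot"
    by (rule at_within_interval_neq_bot[OF assms(2,3) t])
  interpret coordinate_chart c
    by (rule smooth_manifold_coordinate_chart[OF assms(1) c])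
  have g_t: "riemannian_metric A (g s)" and u_t: "smooth_on (chart_img c \<times> I) (\<lambda>(x, t). u t (chart_inv c x))"
    if "s \<in> I" for s
    using assms(4,11) that c by (auto simp: smooth_family_def)
  \<comment> \<open>The spatial identity is used at the fixed time t; other times enter only through
    \<open>dt\<close>.\<close>
  interpret bismut_chart c "g t" "D t" "u t" "H t"
  proof (rule bismut_chartI)
    show "smooth_manifold A" "c \<in> A" "riemannian_metric A (g t)" "levi_civita A (g t) (D t)"
      "two_form A (b t)" "three_form A H0" "H t = (\<lambda>c p. H0 c p + ext_d2 (b t) c p)"
      using assms t c by (auto simp: closed_three_form_def)
    show "smooth_on (chart_img c) (\<lambda>x. u t (chart_inv c x))"
      by (rule smooth_on_slice[OF u_t[OF t] t])
  qed
  have inv: "invertible (g s c p)" and sym: "transpose (g s c p) = g s c p" if "s \<in> I" for s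
    using g_t[OF that] c p invertible_positive_definite[of "g s c p"]
    unfolding riemannian_metric_def by auto
  have time_diff: "(\<lambda>s. T s c p) differentiable (at t within I)" if "smooth_family A I T"
    for T :: "real \<Rightarrow> ('m, 'n) tensor2"
    using smooth_on_time_differentiable[of "chart_img c" I "\<lambda>t x. T t c (chart_inv c x)" "chart_map c p" t]
      that c p t chart_inv_map[OF p] unfolding smooth_family_def by auto
  define g' where "g' = dt I t (\<lambda>s. g s c p)"
  define b' where "b' = dt I t (\<lambda>s. b s c p)"
  have g': "((\<lambda>s. g s c p) has_vector_derivative g') (at t within I)"
    unfolding g'_def by (rule differentiable_has_dt[OF time_diff[OF assms(5)]])
  have b': "((\<lambda>s. b s c p) has_vector_derivative b') (at t within I)"
    unfolding b'_def by (rule differentiable_has_dt[OF time_diff[OF assms(7)]])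
  have dt_add: "dt I t (\<lambda>s. g s c p + b s c p) = g' + b'"
    by (rule dt_eqI[OF bot has_vector_derivative_add[OF g' b']])
  have dt_diff: "dt I t (\<lambda>s. g s c p - b s c p) = g' - b'"
    by (rule dt_eqI[OF bot has_vector_derivative_diff[OF g' b']])
  \<comment> \<open>The heat equation holds throughout the chart domain, so it may be differentiated
    in space.\<close>
  have "pd c i (\<lambda>q. dt I t (\<lambda>s. u s q)) p = pd c i lap p" for i
    by (rule pd_cong[OF _ p]) (simp add: assms(12)[OF t c] laplacian_fun_eq)
  then have "((\<lambda>s. pd c i (u s) p) has_vector_derivative pd c i lap p) (at t within I)" for i
    using has_vector_derivative_pd[OF u_t[OF t] t bot p, of i] by simp
  then have du': "((\<lambda>s. \<chi> i. pd c i (u s) p) has_vector_derivative (\<chi> i. pd c i lap p)) (at t within I)"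
    by (rule has_vector_derivative_vec_lambda)
  have "((\<lambda>s. grad (g s) (u s) c p) has_vector_derivative
      (h p *v (\<chi> i. pd c i lap p) + - (h p ** g' ** h p) *v du p)) (at t within I)"
    using bounded_bilinear.has_vector_derivative[OF bounded_bilinear_matrix_vector_mult
        has_vector_derivative_matrix_inv[OF g' t bot inv] du']
    by (simp add: grad_def sharp_def du_def)
  then have "dt I t (\<lambda>s. grad (g s) (u s) c p) =
      h p *v (\<chi> i. pd c i lap p) + - (h p ** g' ** h p) *v du p"
    by (rule dt_eqI[OF bot])
  \<comment> \<open>\<open>v*\<close> puts the gradient into the first slot of g', while d_t h = - h
    g' h has g' acting on it from the left; symmetry of g' reconciles the two.\<close>
  also have "- (h p ** g' ** h p) *v du p = - (h p *v (grad (g t) (u t) c p v* g'))"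
    using transpose_matrix_vector[of g' "grad (g t) (u t) c p"] dt_symmetric[OF g' t bot sym]
    by (simp add: grad_eq matrix_vector_simps flip: matrix_vector_mul_assoc)
  finally have dt_grad: "dt I t (\<lambda>s. grad (g s) (u s) c p) =
      h p *v (\<chi> i. pd c i lap p) - h p *v (grad (g t) (u t) c p v* g')"
    by (simp add: matrix_vector_simps)
  show "nabla_t I g b c (\<lambda>s. grad (g s) (u s) c) t p =
      laplacian_vec (g t) c (bismut (g t) (H t) (D t) c) (grad (g t) (u t) c) p
      - sharp (g t c p) (grad (g t) (u t) c p v*
          (bismut_ricci (g t) (H t) (D t) c p + (1/2) *\<^sub>R dt I t (\<lambda>s. g s c p - b s c p)))"
    unfolding nabla_t_def laplacian_grad[OF p] dt_add dt_diff dt_grad sharp_def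
    by (simp add: matrix_vector_simps vector_matrix_simps algebra_simps flip: scaleR_add_left)
qed

end
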